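(* Let $H$ be a $2$-balanced graph. There are constants $a,A>0$ such that, for all sufficiently large $n$, the final number of edges $M_n$ in the reverse $H$-free process on $n$ vertices has expectation satisfying $$a\,n^{2-1/d_2(H)}\le\mathbb{E}M_n\le A\,n^{2-1/d_2(H)}.$$ Furthermore, for any $c>0$ we have $|M_n-\mathbb{E}M_n|\le\sqrt{\mathbb{E}M_n}\,(\log n)^{4e_H}$ with probability at least $1-n^{-c}$ for $n\ge n_0(c,H)$.
   Context: For a graph $G$, $v_G$ and $e_G$ denote its numbers of vertices and edges. For $v_G\ge3$ write $d_2(G)=\frac{e_G-1}{v_G-2}$. A fixed graph $H$ is $2$-balanced if it has $e_H\ge2$ edges and all its proper subgraphs $G\subsetneq H$ with $v_G\ge3$ vertices satisfy $\frac{e_G-1}{v_G-2}\le\frac{e_H-1}{v_H-2}=d_2(H)$. The reverse $H$-free process: starting with the complete graph on $n$ vertices, in each step an edge is removed, chosen uniformly at random from all edges that are contained in a copy of $H$ (a not necessarily induced subgraph isomorphic to $H$) in the current graph; the process ends when no such edge exists (so the final graph is $H$-free). $M_n$ is the number of edges of the final graph. *)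

theory Defs
  imports "HOL-Probability.Probability"
begin

record 'a ugraph =
  verts :: "'a set"
  edges :: "'a set set"

definition simple_graph :: "'a ugraph \<Rightarrow> bool" where
  "simple_graph G \<longleftrightarrow> finite (verts G) \<and> (\<forall>e\<in>edges G. e \<subseteq> verts G \<and> card e = 2)"

definition subgraph :: "'a ugraph \<Rightarrow> 'a ugraph \<Rightarrow> bool" where
  "subgraph F G \<longleftrightarrow> simple_graph F \<and> verts F \<subseteq> verts G \<and> edges F \<subseteq> edges G"

definition graph_iso :: "'a ugraph \<Rightarrow> 'b ugraph \<Rightarrow> bool" where
  "graph_iso F G \<longleftrightarrow>
     (\<exists>f. bij_betw f (verts F) (verts G) \<and> edges G = (\<lambda>e. f ` e) ` edges F)"

definition d2 :: "'a ugraph \<Rightarrow> real" where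
  "d2 G = (real (card (edges G)) - 1) / (real (card (verts G)) - 2)"

definition two_balanced :: "'a ugraph \<Rightarrow> bool" where
  "two_balanced H \<longleftrightarrow> card (edges H) \<ge> 2 \<and>
     (\<forall>G. subgraph G H \<and> G \<noteq> H \<and> card (verts G) \<ge> 3 \<longrightarrow> d2 G \<le> d2 H)"

definition complete_graph :: "nat \<Rightarrow> nat ugraph" where
  "complete_graph n = \<lparr>verts = {..<n}, edges = {e. e \<subseteq> {..<n} \<and> card e = 2}\<rparr>"

definition copy_edges :: "'a ugraph \<Rightarrow> 'b ugraph \<Rightarrow> 'b set set" where
  "copy_edges H G = (\<Union>F\<in>{F. subgraph F G \<and> graph_iso H F}. edges F)"

lemma copy_edges_subset: "copy_edges H G \<subseteq> edges G"
  by (auto simp: copy_edges_def subgraph_def)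

definition delete_edge :: "'a set \<Rightarrow> 'a ugraph \<Rightarrow> 'a ugraph" where
  "delete_edge e G = G\<lparr>edges := edges G - {e}\<rparr>"

text \<open>
  The distribution of the final graph of the reverse \<open>H\<close>-free process started from \<open>G\<close>.
  The finiteness guard only serves to make the recursion terminate; it always holds for
  simple graphs.
\<close>

function reverse_free_process :: "'a ugraph \<Rightarrow> 'b ugraph \<Rightarrow> 'b ugraph pmf" where
  "reverse_free_process H G =
     (if finite (edges G) \<and> copy_edges H G \<noteq> {}
      then bind_pmf (pmf_of_set (copy_edges H G)) (\<lambda>e. reverse_free_process H (delete_edge e G))
      else return_pmf G)"
  by pat_completeness auto

termination
proof (relation "Wellfounded.measure (\<lambda>(H, G). card (edges G))", goal_cases)
  case 1
  show ?case by simp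
next
  case (2 H G e)
  then have "e \<in> edges G"
    using copy_edges_subset[of H G] finite_subset[of "copy_edges H G" "edges G"] by auto
  moreover have "finite (edges G)"
    using 2 by simp
  ultimately show ?case
    using card_Diff1_less[of "edges G" e] by (simp add: delete_edge_def)
qed

declare reverse_free_process.simps [simp del]

text \<open>The distribution of the number \<open>M\<^sub>n\<close> of edges of the final graph.\<close>

definition final_edges :: "'a ugraph \<Rightarrow> nat \<Rightarrow> nat pmf" where
  "final_edges H n =
     map_pmf (\<lambda>G. card (edges G)) (reverse_free_process H (complete_graph n))"

abbreviation expected_final_edges :: "'a ugraph \<Rightarrow> nat \<Rightarrow> real" where
  "expected_final_edges H n \<equiv> measure_pmf.expectation (final_edges H n) real"

end

theory Submission
  imports Defs "HOL-Real_Asymp.Real_Asymp"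
begin

text \<open>
  An edge that lies in no copy of \<open>H\<close> at some step never lies in one later. So one may run through all
  edges of the complete graph in uniformly random order and delete an edge iff it lies in a copy
  of \<open>H\<close> formed with edges not yet visited. In the reversed order, an edge survives iff it closes
  no copy of \<open>H\<close> when it is added.

  Prepending \<open>m\<close> independent uniform edges to that order and retaining only first occurrences
  leaves it uniform. So up to the edges that are still unclosed after
  \<open>m\<close> samples, \<open>M\<^sub>n\<close> is a function of independent samples. With \<open>q = n\<^bsup>-1/d\<^esup>\<close>,
  \<open>d = d\<^sub>2(H)\<close> and \<open>k = e\<^sub>H\<close>, 2-balancedness says that at most \<open>O(q\<^bsup>-(k-|J|)\<^esup>)\<close> copies
  contain a given nonempty edge set \<open>J\<close>. By the second moment method a block of \<open>O(n\<^sup>2 q)\<close> samples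
  therefore closes a given edge with probability at least a constant \<open>\<delta>\<close>, and \<open>j\<close> independent
  blocks fail with probability at most \<open>(1 - \<delta>)\<^sup>j\<close>. Summing over time gives the upper bound for
  the mean; the union bound over the first \<open>\<epsilon> n\<^sup>2 q\<close> samples gives the lower bound.

  For the concentration take \<open>j \<approx> (log n)\<^sup>2\<close> blocks. Moments of order \<open>(log n)\<^sup>2\<close> show that with
  overwhelming probability every edge lies in only polylogarithmically many sampled copies. On such
  sample lists the number of kept edges is Lipschitz for the Hamming distance: one passes from one
  list to another through their agreement, by deletions and insertions that keep the list sparse.
  So it extends to a function to which the bounded differences inequality applies.
\<close>

text \<open>Lists are in order of deletion: the head comes last when edges are added one by one.
  The disjunct \<open>x \<in> S\<close> makes repeated entries count as closed.\<close>

definition closed_by :: "'e set set \<Rightarrow> 'e \<Rightarrow> 'e set \<Rightarrow> bool" where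
  "closed_by \<F> x S \<longleftrightarrow> x \<in> S \<or> (\<exists>F\<in>\<F>. x \<in> F \<and> F \<subseteq> insert x S)"

primrec kept :: "'e set set \<Rightarrow> 'e list \<Rightarrow> nat" where
  "kept \<F> [] = 0"
| "kept \<F> (x # xs) = kept \<F> xs + (if closed_by \<F> x (set xs) then 0 else 1)"

lemma closed_by_mono: "closed_by \<F> x S \<Longrightarrow> S \<subseteq> T \<Longrightarrow> closed_by \<F> x T"
  unfolding closed_by_def by blast

text \<open>\<open>remdups\<close> retains the last occurrence of each entry. A dropped entry has an
  equal entry behind it, hence counts 0 through the disjunct \<open>x \<in> S\<close>, and dropping
  it changes no set of entries that is tested.\<close>

lemma kept_remdups: "kept \<F> (remdups xs) = kept \<F> xs"
  by (induction xs) (auto simp: closed_by_def)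

lemma remdups_append_left: "remdups (remdups xs @ ys) = remdups (xs @ ys)"
  by (induction xs) auto

subsection \<open>The process as a random permutation\<close>

abbreviation edge_count :: "'a ugraph \<Rightarrow> 'b ugraph \<Rightarrow> nat pmf" where
  "edge_count H G \<equiv> map_pmf (\<lambda>G. card (edges G)) (reverse_free_process H G)"

lemma edges_delete_edge [simp]: "edges (delete_edge e G) = edges G - {e}"
  by (simp add: delete_edge_def)

lemma delete_edge_commute: "delete_edge e (delete_edge f G) = delete_edge f (delete_edge e G)"
proof -
  have "edges G - {f} - {e} = edges G - {e} - {f}"
    by blast
  then show ?thesis
    by (simp add: delete_edge_def)
qed

lemma copy_edges_delete_mono: "copy_edges H (delete_edge e G) \<subseteq> copy_edges H G"
  unfolding copy_edges_def subgraph_def delete_edge_def by auto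

lemma copy_edges_delete_other:
  assumes "e \<notin> copy_edges H G"
  shows "copy_edges H (delete_edge e G) = copy_edges H G"
proof
  show "copy_edges H G \<subseteq> copy_edges H (delete_edge e G)"
    using assms unfolding copy_edges_def subgraph_def delete_edge_def by fastforce
qed (rule copy_edges_delete_mono)

lemma finite_copy_edges: "finite (edges G) \<Longrightarrow> finite (copy_edges H G)"
  using copy_edges_subset finite_subset by metis

lemma edge_count_rec:
  assumes "finite (edges G)" "copy_edges H G \<noteq> {}"
  shows "edge_count H G =
           bind_pmf (pmf_of_set (copy_edges H G)) (\<lambda>e. edge_count H (delete_edge e G))"
  by (subst reverse_free_process.simps) (use assms in \<open>simp add: map_bind_pmf\<close>)

lemma edge_count_stop:
  assumes "copy_edges H G = {}"
  shows "edge_count H G = return_pmf (card (edges G))"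
  by (subst reverse_free_process.simps) (use assms in simp)

text \<open>Such an edge never gets into a copy again, so the process ignores it and it survives to
  the end. In the induction, after a step \<open>f\<close> it still lies outside all copies, and the
  two deletions commute.\<close>

lemma edge_count_delete_other:
  assumes "finite (edges G)" "e \<in> edges G" "e \<notin> copy_edges H G"
  shows "edge_count H G = map_pmf Suc (edge_count H (delete_edge e G))"
  using assms
proof (induction "card (edges G)" arbitrary: G rule: less_induct)
  case less
  have same: "copy_edges H (delete_edge e G) = copy_edges H G"
    using less.prems copy_edges_delete_other by metis
  show ?case
  proof (cases "copy_edges H G = {}")
    case True
    then have "edge_count H G = return_pmf (card (edges G))"
      and "edge_count H (delete_edge e G) = return_pmf (card (edges G - {e}))"
      using same edge_count_stop[of H G] edge_count_stop[of H "delete_edge e G"] by simp_all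
    then show ?thesis
      using less.prems by (simp only: map_return_pmf card_Suc_Diff1)
  next
    case False
    have fin: "finite (copy_edges H G)"
      using finite_copy_edges less.prems(1) by blast
    have step: "edge_count H (delete_edge f G) =
                  map_pmf Suc (edge_count H (delete_edge f (delete_edge e G)))"
      if f: "f \<in> copy_edges H G" for f
    proof -
      have "f \<in> edges G"
        using f copy_edges_subset by blast
      moreover have "f \<noteq> e"
        using f less.prems by blast
      moreover have "e \<notin> copy_edges H (delete_edge f G)"
        using less.prems copy_edges_delete_mono by blast
      moreover have "card (edges G - {f}) < card (edges G)"
        using calculation(1) less.prems(1) by (simp only: card_Diff1_less)
      ultimately show ?thesis
        using less.hyps[of "delete_edge f G"] less.prems(1,2)
        unfolding delete_edge_commute[of f e] by (simp del: map_pmf_comp)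
    qed
    have "edge_count H G =
            bind_pmf (pmf_of_set (copy_edges H G)) (\<lambda>f. edge_count H (delete_edge f G))"
      by (rule edge_count_rec) (use less.prems False in auto)
    also have "\<dots> = bind_pmf (pmf_of_set (copy_edges H G))
                 (\<lambda>f. map_pmf Suc (edge_count H (delete_edge f (delete_edge e G))))"
      using fin False by (intro bind_pmf_cong step) auto
    also have "\<dots> = map_pmf Suc (bind_pmf (pmf_of_set (copy_edges H G))
                 (\<lambda>f. edge_count H (delete_edge f (delete_edge e G))))"
      by (simp only: map_bind_pmf)
    also have "\<dots> = map_pmf Suc (edge_count H (delete_edge e G))"
      using less.prems False same edge_count_rec[of "delete_edge e G" H] by simp
    finally show ?thesis .
  qed
qed

text \<open>A draw outside \<open>copy_edges H G\<close> is wasted: by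
  \<open>edge_count_delete_other\<close> its summand already has the law of
  \<open>edge_count H G\<close>. The draws inside average to the same law by the recursion, so
  mixing both kinds leaves the law unchanged.\<close>

lemma edge_count_uniform_edge:
  assumes "finite (edges G)" "edges G \<noteq> {}"
  shows "edge_count H G = bind_pmf (pmf_of_set (edges G))
           (\<lambda>e. map_pmf (\<lambda>j. j + (if e \<in> copy_edges H G then 0 else 1))
                  (edge_count H (delete_edge e G)))"
    (is "_ = bind_pmf _ ?g")
proof (rule pmf_eqI)
  fix i
  let ?C = "copy_edges H G" and ?E = "edges G"
  let ?p = "pmf (edge_count H G) i"
  have finC: "finite ?C" and sub: "?C \<subseteq> ?E"
    using finite_copy_edges[OF assms(1)] copy_edges_subset[of H G] by auto
  have out: "pmf (?g e) i = ?p" if "e \<in> ?E - ?C" for e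
    using that assms(1) edge_count_delete_other[of G e H] by (simp del: map_pmf_comp)
  have ins: "(\<Sum>e\<in>?C. pmf (?g e) i) = real (card ?C) * ?p"
  proof (cases "?C = {}")
    case False
    then have "?p = (\<Sum>e\<in>?C. pmf (edge_count H (delete_edge e G)) i) / real (card ?C)"
      using finC assms(1) by (subst edge_count_rec) (simp_all add: pmf_bind_pmf_of_set)
    moreover have "(\<Sum>e\<in>?C. pmf (?g e) i) = (\<Sum>e\<in>?C. pmf (edge_count H (delete_edge e G)) i)"
      by (intro sum.cong) auto
    moreover have "real (card ?C) \<noteq> 0"
      using False finC by simp
    ultimately show ?thesis
      by (simp only: times_divide_eq_right nonzero_mult_div_cancel_left not_False_eq_True)
  qed simp
  have "(\<Sum>e\<in>?E. pmf (?g e) i) = (\<Sum>e\<in>?C. pmf (?g e) i) + (\<Sum>e\<in>?E-?C. pmf (?g e) i)"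
    by (subst add.commute) (rule sum.subset_diff[OF sub assms(1)])
  also have "\<dots> = real (card ?C) * ?p + real (card (?E - ?C)) * ?p"
    by (simp only: ins sum.cong[OF refl out] sum_constant)
  also have "\<dots> = real (card ?E) * ?p"
  proof -
    have "real (card ?E) = real (card ?C) + real (card (?E - ?C))"
      by (metis of_nat_add card_Diff_subset card_mono finC sub assms(1) le_add_diff_inverse)
    then show ?thesis
      by (simp only: distrib_right)
  qed
  finally show "?p = pmf (bind_pmf (pmf_of_set ?E) ?g) i"
    using assms by (simp add: pmf_bind_pmf_of_set)
qed

text \<open>The head of the permutation is the edge visited first, and the tail consists of the
  edges not yet visited. The assumption speaks of all \<open>S\<close> so that it passes on to
  \<open>delete_edge e G\<close> in the induction.\<close>

lemma edge_count_permutation: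
  assumes "finite (edges G)"
    and "\<And>S. S \<subseteq> edges G \<Longrightarrow> copy_edges H (G\<lparr>edges := S\<rparr>) = \<Union>{F\<in>\<F>. F \<subseteq> S}"
  shows "edge_count H G = map_pmf (kept \<F>) (pmf_of_set (permutations_of_set (edges G)))"
  using assms
proof (induction "card (edges G)" arbitrary: G rule: less_induct)
  case less
  show ?case
  proof (cases "edges G = {}")
    case True
    then have "copy_edges H G = {}"
      using copy_edges_subset by fastforce
    then show ?thesis
      using True by (simp add: edge_count_stop pmf_of_set_singleton)
  next
    case False
    let ?E = "edges G"
    have IH: "edge_count H (delete_edge e G) =
                map_pmf (kept \<F>) (pmf_of_set (permutations_of_set (?E - {e})))"
      if "e \<in> ?E" for e
    proof -
      have "card (?E - {e}) < card ?E"
        using that less.prems(1) by (simp only: card_Diff1_less)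
      then show ?thesis
        using less.hyps[of "delete_edge e G"] less.prems that
        by (simp add: delete_edge_def subset_Diff_insert del: map_pmf_comp)
    qed
    have closed: "e \<in> copy_edges H G \<longleftrightarrow> closed_by \<F> e (?E - {e})" if "e \<in> ?E" for e
    proof -
      have "copy_edges H G = \<Union>{F\<in>\<F>. F \<subseteq> ?E}"
        using less.prems(2)[of ?E] by simp
      then show ?thesis
        using that unfolding closed_by_def by (auto simp: insert_absorb)
    qed
    have "edge_count H G = bind_pmf (pmf_of_set ?E)
           (\<lambda>e. map_pmf (\<lambda>j. j + (if e \<in> copy_edges H G then 0 else 1))
                  (edge_count H (delete_edge e G)))"
      by (rule edge_count_uniform_edge) (use less.prems False in auto)
    also have "\<dots> = bind_pmf (pmf_of_set ?E) (\<lambda>e. map_pmf (\<lambda>xs. kept \<F> (e # xs))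
                      (pmf_of_set (permutations_of_set (?E - {e}))))"
    proof (rule bind_pmf_cong)
      fix e assume "e \<in> set_pmf (pmf_of_set ?E)"
      then have e: "e \<in> ?E"
        using less.prems False by simp
      have "map_pmf (\<lambda>j. j + (if e \<in> copy_edges H G then 0 else 1)) (edge_count H (delete_edge e G))
          = map_pmf (\<lambda>xs. kept \<F> xs + (if e \<in> copy_edges H G then 0 else 1))
              (pmf_of_set (permutations_of_set (?E - {e})))"
        unfolding IH[OF e] pmf.map_comp by (simp add: o_def)
      also have "\<dots> = map_pmf (\<lambda>xs. kept \<F> (e # xs)) (pmf_of_set (permutations_of_set (?E - {e})))"
      proof (rule map_pmf_cong)
        fix xs assume "xs \<in> set_pmf (pmf_of_set (permutations_of_set (?E - {e})))"
        then have "set xs = ?E - {e}"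
          using less.prems by (auto simp: permutations_of_setD)
        then show "kept \<F> xs + (if e \<in> copy_edges H G then 0 else 1) = kept \<F> (e # xs)"
          using closed[OF e] by simp
      qed simp
      finally show "map_pmf (\<lambda>j. j + (if e \<in> copy_edges H G then 0 else 1))
                      (edge_count H (delete_edge e G))
          = map_pmf (\<lambda>xs. kept \<F> (e # xs)) (pmf_of_set (permutations_of_set (?E - {e})))" .
    qed simp
    also have "\<dots> = map_pmf (kept \<F>) (pmf_of_set (permutations_of_set ?E))"
      using less.prems False
      by (simp add: random_permutation_of_set map_bind_pmf map_pmf_def bind_assoc_pmf bind_return_pmf)
    finally show ?thesis .
  qed
qed

subsection \<open>Prepending independent samples to a permutation\<close>

lemma random_permutation_rev:
  assumes "finite A"
  shows "map_pmf rev (pmf_of_set (permutations_of_set A)) = pmf_of_set (permutations_of_set A)"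
proof (rule map_pmf_of_set_bij_betw)
  show "bij_betw rev (permutations_of_set A) (permutations_of_set A)"
    by (rule bij_betw_byWitness[where f' = rev]) (auto simp: permutations_of_set_def)
qed (use assms in auto)

lemma random_permutation_filter:
  assumes "finite A"
  shows "map_pmf (filter P) (pmf_of_set (permutations_of_set A)) =
         pmf_of_set (permutations_of_set {x\<in>A. P x})"
proof -
  have "map_pmf (filter P) (pmf_of_set (permutations_of_set A)) =
        map_pmf fst (map_pmf (partition P) (pmf_of_set (permutations_of_set A)))"
    by (simp add: pmf.map_comp o_def)
  then show ?thesis
    by (simp add: partition_random_permutations[OF assms] map_fst_pair_pmf)
qed

text \<open>Erasing \<open>x\<close> leaves a uniform permutation of \<open>A - {x}\<close>; a
  uniform \<open>x\<close> behind it makes the whole uniform on \<open>A\<close> again.\<close>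

lemma random_permutation_move_to_end:
  assumes "finite A" "A \<noteq> {}"
  shows "bind_pmf (pmf_of_set A) (\<lambda>x. map_pmf (\<lambda>xs. remdups (xs @ [x]))
           (pmf_of_set (permutations_of_set A))) = pmf_of_set (permutations_of_set A)"
proof -
  have "map_pmf (\<lambda>xs. remdups (xs @ [x])) (pmf_of_set (permutations_of_set A)) =
        map_pmf (\<lambda>ys. ys @ [x]) (map_pmf rev (pmf_of_set (permutations_of_set (A - {x}))))"
    if "x \<in> A" for x
  proof -
    have "remdups (xs @ [x]) = filter (\<lambda>y. y \<noteq> x) xs @ [x]" if "distinct xs" for xs
      using that by (induction xs) auto
    then have "map_pmf (\<lambda>xs. remdups (xs @ [x])) (pmf_of_set (permutations_of_set A)) =
        map_pmf (\<lambda>xs. filter (\<lambda>y. y \<noteq> x) xs @ [x]) (pmf_of_set (permutations_of_set A))"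
      using assms by (intro map_pmf_cong) (auto simp: permutations_of_setD)
    also have "\<dots> = map_pmf (\<lambda>ys. ys @ [x])
        (map_pmf (filter (\<lambda>y. y \<noteq> x)) (pmf_of_set (permutations_of_set A)))"
      by (simp add: pmf.map_comp o_def)
    \<comment> \<open>The reversal turns appending \<open>x\<close> into
      \<open>rev (x # xs)\<close>, which fits the decomposition of a random permutation by its
      head.\<close>
    also have "map_pmf (filter (\<lambda>y. y \<noteq> x)) (pmf_of_set (permutations_of_set A)) =
               map_pmf rev (pmf_of_set (permutations_of_set (A - {x})))"
      using assms by (simp add: random_permutation_filter random_permutation_rev set_diff_eq)
    finally show ?thesis .
  qed
  then have "bind_pmf (pmf_of_set A) (\<lambda>x. map_pmf (\<lambda>xs. remdups (xs @ [x]))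
               (pmf_of_set (permutations_of_set A))) =
             bind_pmf (pmf_of_set A) (\<lambda>x. map_pmf (\<lambda>xs. rev xs @ [x])
               (pmf_of_set (permutations_of_set (A - {x}))))"
    using assms by (intro bind_pmf_cong) (auto simp: pmf.map_comp o_def)
  also have "\<dots> = map_pmf rev (pmf_of_set (permutations_of_set A))"
    using assms
    by (subst random_permutation_of_set) (simp_all add: map_bind_pmf map_pmf_def bind_assoc_pmf bind_return_pmf)
  finally show ?thesis
    using assms by (simp add: random_permutation_rev)
qed

text \<open>Move a uniform element to the end of the permutation, once per sample;
  \<open>kept\<close> does not notice that the earlier occurrence stays in place. Since lists are
  added from the end, the samples come before the permutation in time.\<close>

lemma kept_permutation_samples:
  assumes "finite A" "A \<noteq> {}"
  shows "map_pmf (kept \<F>) (pmf_of_set (permutations_of_set A)) =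
         bind_pmf (pmf_of_set (permutations_of_set A))
           (\<lambda>ys. map_pmf (\<lambda>xs. kept \<F> (ys @ xs)) (replicate_pmf m (pmf_of_set A)))"
proof (induction m)
  case 0
  then show ?case by (simp add: map_pmf_def bind_return_pmf)
next
  case (Suc m)
  let ?P = "pmf_of_set (permutations_of_set A)" and ?R = "replicate_pmf m (pmf_of_set A)"
  have k: "kept \<F> (remdups (ys @ [x]) @ xs) = kept \<F> (ys @ x # xs)" for ys x xs
    by (metis kept_remdups remdups_append_left append.assoc append_Cons append_Nil)
  have "map_pmf (kept \<F>) ?P = bind_pmf ?P (\<lambda>ys. map_pmf (\<lambda>xs. kept \<F> (ys @ xs)) ?R)"
    by (rule Suc)
  also have "\<dots> = bind_pmf (bind_pmf (pmf_of_set A) (\<lambda>x. map_pmf (\<lambda>ys. remdups (ys @ [x])) ?P))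
                 (\<lambda>ys. map_pmf (\<lambda>xs. kept \<F> (ys @ xs)) ?R)"
    by (simp only: random_permutation_move_to_end[OF assms])
  also have "\<dots> = bind_pmf (pmf_of_set A) (\<lambda>x. bind_pmf ?P
                 (\<lambda>ys. map_pmf (\<lambda>xs. kept \<F> (ys @ x # xs)) ?R))"
    by (simp only: bind_assoc_pmf bind_map_pmf k)
  also have "\<dots> = bind_pmf ?P (\<lambda>ys. bind_pmf (pmf_of_set A)
                 (\<lambda>x. map_pmf (\<lambda>xs. kept \<F> (ys @ x # xs)) ?R))"
    by (rule bind_commute_pmf)
  also have "\<dots> = bind_pmf ?P (\<lambda>ys. map_pmf (\<lambda>xs. kept \<F> (ys @ xs)) (replicate_pmf (Suc m) (pmf_of_set A)))"
    by (simp add: map_bind_pmf) (simp add: map_pmf_def)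
  finally show ?case .
qed

subsection \<open>Independent samples from a finite set\<close>

lemma prob_eq_expectation:
  "measure_pmf.prob p {x. P x} = measure_pmf.expectation p (\<lambda>x. of_bool (P x))"
proof -
  have "(\<lambda>x. of_bool (P x)) = (indicator {x. P x} :: _ \<Rightarrow> real)"
    by (simp add: fun_eq_iff indicator_def)
  then show ?thesis
    by simp
qed

lemma power_add_ge_linear:
  fixes u v :: real
  assumes "u \<ge> 0" "v \<ge> 0"
  shows "u ^ s + real s * v * u ^ (s - 1) \<le> (u + v) ^ s"
proof (induction s)
  case (Suc s)
  have "u ^ Suc s + real (Suc s) * v * u ^ s \<le> (u + v) * (u ^ s + real s * v * u ^ (s - 1))"
    using assms by (cases s) (simp_all add: algebra_simps)
  also have "\<dots> \<le> (u + v) * (u + v) ^ s"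
    using assms Suc by (intro mult_left_mono) auto
  finally show ?case
    by simp
qed simp

locale sampling =
  fixes E :: "'e set"
  assumes finite_E [simp]: "finite E" and E_nonempty [simp]: "E \<noteq> {}"
begin

abbreviation samples :: "nat \<Rightarrow> 'e list pmf" where
  "samples m \<equiv> replicate_pmf m (pmf_of_set E)"

abbreviation expect :: "nat \<Rightarrow> ('e list \<Rightarrow> real) \<Rightarrow> real" where
  "expect m \<equiv> measure_pmf.expectation (samples m)"

abbreviation N :: real where
  "N \<equiv> real (card E)"

lemma N_pos: "N > 0"
  by (simp add: card_gt_0_iff)

lemma set_samples: "set_pmf (samples m) = {xs. length xs = m \<and> set xs \<subseteq> E}"
  by (auto simp: set_replicate_pmf)

lemma finite_samples [simp]: "finite (set_pmf (samples m))"
  using finite_lists_length_eq[OF finite_E, of m] by (simp add: set_samples conj_commute)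

lemma integrable_samples [simp]: "integrable (measure_pmf (samples m)) f" for f :: "_ \<Rightarrow> real"
  by (rule integrable_measure_pmf_finite) simp

lemma expect_Suc: "expect (Suc m) f = (\<Sum>x\<in>E. expect m (\<lambda>xs. f (x # xs))) / N"
proof -
  have "expect (Suc m) f =
    (\<Sum>x\<in>E. measure_pmf.expectation (map_pmf ((#) x) (samples m)) f /\<^sub>R N)"
    unfolding replicate_pmf.simps map_pmf_def[symmetric]
    by (subst pmf_expectation_bind_pmf_of_set) auto
  then show ?thesis
    by (simp add: divide_inverse mult.commute sum_distrib_left)
qed

lemma expect_add: "expect (l + m) f = expect l (\<lambda>xs. expect m (\<lambda>ys. f (xs @ ys)))"
  by (induction l arbitrary: f) (simp_all add: expect_Suc del: replicate_pmf.simps(2))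

lemma expect_mono:
  assumes "\<And>xs. length xs = m \<Longrightarrow> set xs \<subseteq> E \<Longrightarrow> f xs \<le> g xs"
  shows "expect m f \<le> expect m g"
  by (rule integral_mono_AE) (use assms in \<open>auto simp: AE_measure_pmf_iff set_samples\<close>)

lemma expect_cong:
  assumes "\<And>xs. length xs = m \<Longrightarrow> set xs \<subseteq> E \<Longrightarrow> f xs = g xs"
  shows "expect m f = expect m g"
  by (rule integral_cong_AE) (use assms in \<open>auto simp: AE_measure_pmf_iff set_samples\<close>)

lemma expect_nonneg:
  assumes "\<And>xs. length xs = m \<Longrightarrow> set xs \<subseteq> E \<Longrightarrow> 0 \<le> f xs"
  shows "0 \<le> expect m f"
  using expect_mono[of m "\<lambda>_. 0" f] assms by simp

text \<open>Condition on the first sample: in at most \<open>card U\<close> of the \<open>N\<close>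
  cases it removes one element from the demand. The resulting recursion yields the first two terms
  of the expansion of \<open>(real m / N + 1 / N) ^ card U\<close>.\<close>

lemma expect_subset_le:
  assumes "finite U"
  shows "expect m (\<lambda>xs. of_bool (U \<subseteq> set xs)) \<le> (real m / N) ^ card U"
  using assms
proof (induction m arbitrary: U)
  case 0
  then show ?case
    by (cases "U = {}") auto
next
  case (Suc m)
  let ?u = "real m / N" and ?s = "card U"
  have "expect m (\<lambda>xs. of_bool (U \<subseteq> set (x # xs))) \<le>
        ?u ^ ?s + (if x \<in> U then ?u ^ (?s - 1) else 0)" for x
  proof (cases "x \<in> U")
    case True
    then have "U \<subseteq> set (x # xs) \<longleftrightarrow> U - {x} \<subseteq> set xs" for xs
      by auto
    then have "expect m (\<lambda>xs. of_bool (U \<subseteq> set (x # xs))) \<le> ?u ^ card (U - {x})"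
      using Suc.IH[of "U - {x}"] Suc.prems by (simp only: finite_Diff)
    then show ?thesis
      using True Suc.prems by (simp add: add_increasing)
  next
    case False
    then have "U \<subseteq> set (x # xs) \<longleftrightarrow> U \<subseteq> set xs" for xs
      by auto
    then show ?thesis
      using Suc.IH[of "U"] Suc.prems False by (simp only:) simp
  qed
  then have "expect (Suc m) (\<lambda>xs. of_bool (U \<subseteq> set xs)) \<le>
        (\<Sum>x\<in>E. ?u ^ ?s + (if x \<in> U then ?u ^ (?s - 1) else 0)) / N"
    unfolding expect_Suc by (intro divide_right_mono sum_mono) auto
  also have "\<dots> = ?u ^ ?s + real (card (E \<inter> U)) * (1 / N) * ?u ^ (?s - 1)"
  proof -
    have "(\<Sum>x\<in>E. if x \<in> U then ?u ^ (?s - 1) else 0) = real (card (E \<inter> U)) * ?u ^ (?s - 1)"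
      by (simp add: sum.If_cases Int_def)
    then show ?thesis
      using N_pos by (simp add: sum.distrib add_divide_distrib)
  qed
  also have "\<dots> \<le> ?u ^ ?s + real ?s * (1 / N) * ?u ^ (?s - 1)"
    using Suc.prems by (intro add_left_mono mult_right_mono) (auto intro: card_mono)
  also have "\<dots> \<le> (?u + 1 / N) ^ ?s"
    by (rule power_add_ge_linear) auto
  also have "?u + 1 / N = real (Suc m) / N"
    by (simp add: add_divide_distrib)
  finally show ?case .
qed

lemma expect_avoid:
  assumes "x \<in> E"
  shows "expect m (\<lambda>xs. of_bool (x \<notin> set xs)) = (1 - 1 / N) ^ m"
proof (induction m)
  case (Suc m)
  have "expect m (\<lambda>xs. of_bool (x \<notin> set (y # xs))) = (if y = x then 0 else (1 - 1 / N) ^ m)" for y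
    using Suc by auto
  then have "expect (Suc m) (\<lambda>xs. of_bool (x \<notin> set xs)) =
               (\<Sum>y\<in>E. if y = x then 0 else (1 - 1 / N) ^ m) / N"
    by (simp only: expect_Suc)
  also have "(\<Sum>y\<in>E. if y = x then 0 else (1 - 1 / N) ^ m) = (\<Sum>y\<in>E - {x}. (1 - 1 / N) ^ m)"
    by (rule sum.mono_neutral_cong_right) auto
  also have "\<dots> / N = (1 - 1 / N) ^ Suc m"
    using assms N_pos by (simp add: card_Diff_singleton of_nat_diff Suc_le_eq card_gt_0_iff field_simps)
  finally show ?case .
qed simp

text \<open>Reserve a separate batch of \<open>b\<close> samples for each element of
  \<open>A\<close>; the batches are independent. One batch hits its element with probability
  \<open>1 - (1 - 1 / N) ^ b\<close>, at least \<open>1 - exp (- q)\<close>, and this is at least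
  \<open>q / 2\<close> because \<open>(1 + q) * (1 - q / 2) \<ge> 1\<close> for \<open>q\<close> in
  the unit interval.\<close>

lemma expect_subset_ge:
  assumes "A \<subseteq> E" and "q \<ge> 0" "q \<le> 1" "N * q \<le> real b"
  shows "(q / 2) ^ card A \<le> expect (card A * b) (\<lambda>xs. of_bool (A \<subseteq> set xs))"
proof -
  have "finite A"
    using assms(1) finite_E finite_subset by blast
  then show ?thesis
    using assms(1)
  proof (induction A)
    case (insert a A)
    then have aE: "a \<in> E"
      by blast
    have "(1 - 1 / N) ^ b \<le> exp (- (1 / N)) ^ b"
      using N_pos exp_ge_add_one_self[of "- (1 / N)"] by (intro power_mono) (auto simp: Suc_le_eq card_gt_0_iff)
    also have "\<dots> = exp (- (real b / N))"
      by (simp add: exp_of_nat_mult[symmetric])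
    also have "\<dots> \<le> exp (- q)"
      using assms(4) N_pos by (simp add: field_simps)
    also have "\<dots> \<le> 1 / (1 + q)"
      using assms(2) exp_ge_add_one_self[of q] by (simp add: exp_minus divide_inverse le_imp_inverse_le)
    also have "\<dots> \<le> 1 - q / 2"
      using assms(2,3) by (simp add: field_simps) (simp add: mult_left_le)
    finally have "q / 2 \<le> 1 - (1 - 1 / N) ^ b"
      by simp
    also have "\<dots> = expect b (\<lambda>xs. 1 - of_bool (a \<notin> set xs))"
      using aE by (simp only: integrable_samples Bochner_Integration.integral_diff expect_avoid) simp
    also have "\<dots> = expect b (\<lambda>xs. of_bool (a \<in> set xs))"
      by (rule expect_cong) auto
    finally have a: "q / 2 \<le> expect b (\<lambda>xs. of_bool (a \<in> set xs))" .
    have "(q / 2) ^ card (insert a A) \<le>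
        expect b (\<lambda>xs. of_bool (a \<in> set xs)) * expect (card A * b) (\<lambda>ys. of_bool (A \<subseteq> set ys))"
      unfolding card_insert_disjoint[OF insert.hyps(1,2)] power_Suc
      by (rule mult_mono) (use insert a assms(2) in \<open>auto intro!: expect_nonneg\<close>)
    also have "\<dots> = expect b (\<lambda>xs. expect (card A * b)
                      (\<lambda>ys. of_bool (a \<in> set xs) * of_bool (A \<subseteq> set ys)))"
      by simp
    also have "\<dots> \<le> expect b (\<lambda>xs. expect (card A * b) (\<lambda>ys. of_bool (insert a A \<subseteq> set (xs @ ys))))"
      by (intro expect_mono) auto
    also have "\<dots> = expect (card (insert a A) * b) (\<lambda>xs. of_bool (insert a A \<subseteq> set xs))"
      unfolding card_insert_disjoint[OF insert.hyps(1,2)] mult_Suc by (rule expect_add[symmetric])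
    finally show ?case .
  qed simp
qed

text \<open>Linearity of expectation: the sample with \<open>i\<close> entries behind it is uniform
  and independent of those entries.\<close>

lemma expect_kept:
  "expect m (\<lambda>xs. real (kept \<F> xs)) =
     (\<Sum>i<m. (\<Sum>x\<in>E. expect i (\<lambda>xs. of_bool (\<not> closed_by \<F> x (set xs)))) / N)"
proof (induction m)
  case (Suc m)
  have "expect m (\<lambda>xs. real (kept \<F> (x # xs))) =
        expect m (\<lambda>xs. real (kept \<F> xs)) + expect m (\<lambda>xs. of_bool (\<not> closed_by \<F> x (set xs)))" for x
    by (subst Bochner_Integration.integral_add[symmetric]) (auto intro!: expect_cong)
  then have "expect (Suc m) (\<lambda>xs. real (kept \<F> xs)) =
    (\<Sum>x\<in>E. expect m (\<lambda>xs. real (kept \<F> xs)) + expect m (\<lambda>xs. of_bool (\<not> closed_by \<F> x (set xs)))) / N"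
    by (simp only: expect_Suc)
  also have "\<dots> = expect m (\<lambda>xs. real (kept \<F> xs)) +
                   (\<Sum>x\<in>E. expect m (\<lambda>xs. of_bool (\<not> closed_by \<F> x (set xs)))) / N"
    by (simp add: sum.distrib add_divide_distrib)
  finally show ?case
    using Suc by simp
qed simp

end

subsection \<open>Regular hypergraphs\<close>

text \<open>Abstracts the copies of \<open>H\<close> in the complete graph. At density
  \<open>q\<close> a fixed element is closed by about constantly many members of \<F>;
  \<open>codegree_le\<close> is the form in which 2-balancedness enters, and \<open>Nq_ge\<close>
  allows rounding errors to be absorbed into constants.\<close>

locale regular_hypergraph = sampling E for E :: "'e set" +
  fixes \<F> :: "'e set set" and k :: nat and q c C :: real
  assumes edge_subset: "F \<in> \<F> \<Longrightarrow> F \<subseteq> E" and edge_card: "F \<in> \<F> \<Longrightarrow> card F = k"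
    and k_ge_2: "k \<ge> 2"
    and q_pos: "0 < q" and q_le_1: "q \<le> 1" and Nq_ge: "1 / 4 \<le> real (card E) * q"
    and c_pos: "c > 0"
    and degree_ge: "x \<in> E \<Longrightarrow> c * (1 / q) ^ (k - 1) \<le> real (card {F\<in>\<F>. x \<in> F})"
    and codegree_le: "J \<noteq> {} \<Longrightarrow> J \<subseteq> E \<Longrightarrow> card J \<le> k \<Longrightarrow>
                        real (card {F\<in>\<F>. J \<subseteq> F}) \<le> C * (1 / q) ^ (k - card J)"
begin

definition link :: "'e \<Rightarrow> 'e set set" where
  "link x = {A. x \<notin> A \<and> insert x A \<in> \<F>}"

lemma link_subset: "A \<in> link x \<Longrightarrow> A \<subseteq> E"
  using edge_subset by (auto simp: link_def)

lemma finite_link [simp]: "finite (link x)"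
  by (rule finite_subset[of _ "Pow E"]) (use link_subset in auto)

lemma finite_in_link: "A \<in> link x \<Longrightarrow> finite A"
  using link_subset finite_E finite_subset by metis

lemma link_card: "A \<in> link x \<Longrightarrow> card A = k - 1"
  using edge_card[of "insert x A"] finite_in_link[of A x] by (auto simp: link_def)

lemma closed_by_link: "closed_by \<F> x S \<longleftrightarrow> x \<in> S \<or> (\<exists>A\<in>link x. A \<subseteq> S)"
proof -
  have "(\<exists>F\<in>\<F>. x \<in> F \<and> F \<subseteq> insert x S) \<longleftrightarrow> (\<exists>A\<in>link x. A \<subseteq> S)" if "x \<notin> S"
  proof
    assume "\<exists>F\<in>\<F>. x \<in> F \<and> F \<subseteq> insert x S"
    then obtain F where "F \<in> \<F>" "x \<in> F" "F \<subseteq> insert x S"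
      by blast
    then have "F - {x} \<in> link x" "F - {x} \<subseteq> S"
      by (auto simp: link_def insert_absorb)
    then show "\<exists>A\<in>link x. A \<subseteq> S"
      by blast
  qed (auto simp: link_def)
  then show ?thesis
    unfolding closed_by_def by blast
qed

lemma card_link_superset:
  assumes "x \<notin> J"
  shows "card {A\<in>link x. J \<subseteq> A} = card {F\<in>\<F>. insert x J \<subseteq> F}"
proof (rule bij_betw_same_card[of "insert x"])
  show "bij_betw (insert x) {A\<in>link x. J \<subseteq> A} {F\<in>\<F>. insert x J \<subseteq> F}"
    by (rule bij_betw_byWitness[where f' = "\<lambda>F. F - {x}"])
      (use assms in \<open>auto simp: link_def insert_absorb\<close>)
qed

lemma card_link_ge:
  assumes "x \<in> E"
  shows "c * (1 / q) ^ (k - 1) \<le> real (card (link x))"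
  using degree_ge[OF assms] card_link_superset[of x "{}"] by simp

lemma card_link_superset_le:
  assumes "x \<in> E" "x \<notin> J" "J \<subseteq> E" "card J \<le> k - 1"
  shows "real (card {A\<in>link x. J \<subseteq> A}) \<le> C * (1 / q) ^ (k - 1 - card J)"
proof -
  have "finite J"
    using assms finite_E finite_subset by blast
  then show ?thesis
    using codegree_le[of "insert x J"] assms k_ge_2 by (simp add: card_link_superset)
qed

lemma C_ge_c: "c \<le> C"
proof -
  obtain x where "x \<in> E"
    using E_nonempty by blast
  then have "c * (1 / q) ^ (k - 1) \<le> C * (1 / q) ^ (k - 1)"
    using card_link_ge[of x] card_link_superset_le[of x "{}"] by simp
  then show ?thesis
    using q_pos by simp
qed

lemma C_pos: "C > 0"
  using C_ge_c c_pos by simp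

text \<open>Bounds the expected number of sets of \<open>link x\<close> completed once
  \<open>U\<close> is present, at density \<open>p\<close>. Group them by
  \<open>J = A \<inter> U\<close>: the codegree bound contributes
  \<open>(1 / q) ^ (k - 1 - card J)\<close>, the missing elements contribute
  \<open>(\<mu> * q) ^ (k - 1 - card J)\<close>, and the powers of \<open>q\<close> cancel. Summing
  over \<open>J\<close> by size gives a binomial expansion.\<close>

lemma link_sum_le:
  assumes "x \<in> E" "finite U" "card U \<le> R" "0 \<le> p" "p \<le> \<mu> * q"
  shows "(\<Sum>A\<in>link x. p ^ card (A - U)) \<le> C * (real R + \<mu>) ^ (k - 1)"
proof -
  let ?J = "{J. J \<subseteq> U \<and> card J \<le> k - 1}"
  have lam: "\<mu> \<ge> 0"
    using assms(4,5) q_pos by (meson order_trans zero_le_mult_iff not_less)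
  have finJ: "finite ?J"
    using assms(2) by simp
  have inner: "(\<Sum>A\<in>{A\<in>link x. A \<inter> U = J}. p ^ card (A - U)) \<le> C * \<mu> ^ (k - 1 - card J)"
    if "J \<in> ?J" for J
  proof (cases "{A\<in>link x. A \<inter> U = J} = {}")
    case True
    then show ?thesis
      using C_pos lam by (simp only: sum.empty) simp
  next
    case False
    \<comment> \<open>A member of the class shows that \<open>x \<notin> J\<close> and
      \<open>J \<subseteq> E\<close>, as \<open>card_link_superset_le\<close> demands.\<close>
    then obtain B where B: "B \<in> link x" "B \<inter> U = J"
      by blast
    have card: "card (A - U) = k - 1 - card J" if "A \<in> link x" "A \<inter> U = J" for A
    proof -
      have "card (A - U) = card A - card (A \<inter> U)"
        by (rule card_Diff_subset_Int) (use finite_in_link[OF that(1)] in blast)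
      then show ?thesis
        by (simp only: link_card[OF that(1)] that(2))
    qed
    have "(\<Sum>A\<in>{A\<in>link x. A \<inter> U = J}. p ^ card (A - U)) =
          real (card {A\<in>link x. A \<inter> U = J}) * p ^ (k - 1 - card J)"
      by (subst sum.cong[OF refl, of _ _ "\<lambda>_. p ^ (k - 1 - card J)"]) (use card in auto)
    also have "\<dots> \<le> (C * (1 / q) ^ (k - 1 - card J)) * (\<mu> * q) ^ (k - 1 - card J)"
    proof (intro mult_mono power_mono)
      have "real (card {A\<in>link x. A \<inter> U = J}) \<le> real (card {A\<in>link x. J \<subseteq> A})"
        by (intro of_nat_mono card_mono) auto
      also have "\<dots> \<le> C * (1 / q) ^ (k - 1 - card J)"
        using B link_subset[of B x] that by (intro card_link_superset_le[OF assms(1)])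
          (auto simp: link_def)
      finally show "real (card {A\<in>link x. A \<inter> U = J}) \<le> C * (1 / q) ^ (k - 1 - card J)" .
    qed (use assms C_pos q_pos in auto)
    also have "\<dots> = C * \<mu> ^ (k - 1 - card J)"
      using q_pos by (simp add: power_mult_distrib power_divide)
    finally show ?thesis .
  qed
  have "(\<Sum>A\<in>link x. p ^ card (A - U)) =
        (\<Sum>J\<in>?J. \<Sum>A\<in>{A\<in>link x. A \<inter> U = J}. p ^ card (A - U))"
  proof (rule sum.group[symmetric])
    show "(\<lambda>A. A \<inter> U) ` link x \<subseteq> ?J"
    proof
      fix J assume "J \<in> (\<lambda>A. A \<inter> U) ` link x"
      then obtain A where A: "A \<in> link x" and J: "J = A \<inter> U"
        by blast
      have "card (A \<inter> U) \<le> card A"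
        by (rule card_mono) (use finite_in_link[OF A] in auto)
      then show "J \<in> ?J"
        using link_card[OF A] J by simp
    qed
  qed (use finJ in auto)
  also have "\<dots> \<le> (\<Sum>J\<in>?J. C * \<mu> ^ (k - 1 - card J))"
    by (intro sum_mono inner)
  also have "\<dots> = (\<Sum>j\<le>k - 1. \<Sum>J\<in>{J\<in>?J. card J = j}. C * \<mu> ^ (k - 1 - card J))"
    by (rule sum.group[symmetric]) (use finJ in auto)
  also have "\<dots> \<le> (\<Sum>j\<le>k - 1. C * (real (k - 1 choose j) * real R ^ j * \<mu> ^ (k - 1 - j)))"
  proof (rule sum_mono)
    fix j assume j: "j \<in> {..k - 1}"
    have "{J\<in>?J. card J = j} = {J. J \<subseteq> U \<and> card J = j}"
      using j by auto
    then have "(\<Sum>J\<in>{J\<in>?J. card J = j}. C * \<mu> ^ (k - 1 - card J)) =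
               real (card U choose j) * (C * \<mu> ^ (k - 1 - j))"
      using n_subsets[OF assms(2), of j] by simp
    \<comment> \<open>The factor \<open>k - 1 choose j\<close> is at least 1 and is inserted only to
      complete the binomial expansion of \<open>(real R + \<mu>) ^ (k - 1)\<close>.\<close>
    also have "real (card U choose j) \<le> real (k - 1 choose j) * real R ^ j"
    proof -
      have "card U choose j \<le> card U ^ j"
        by (cases "j \<le> card U") (auto simp: binomial_le_pow binomial_eq_0)
      also have "\<dots> \<le> R ^ j"
        using assms(3) by (rule power_mono) simp
      also have "\<dots> \<le> (k - 1 choose j) * R ^ j"
      proof -
        have "1 \<le> k - 1 choose j"
          using j zero_less_binomial[of j "k - 1"] by (simp only: atMost_iff Suc_leI One_nat_def)
        then show ?thesis
          using mult_le_mono1[of 1 "k - 1 choose j" "R ^ j"] by simp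
      qed
      finally show ?thesis
        by (metis of_nat_le_iff of_nat_mult of_nat_power)
    qed
    then have "real (card U choose j) * (C * \<mu> ^ (k - 1 - j)) \<le>
               (real (k - 1 choose j) * real R ^ j) * (C * \<mu> ^ (k - 1 - j))"
      using C_pos lam by (intro mult_right_mono) auto
    finally show "(\<Sum>J\<in>{J\<in>?J. card J = j}. C * \<mu> ^ (k - 1 - card J)) \<le>
                  C * (real (k - 1 choose j) * real R ^ j * \<mu> ^ (k - 1 - j))"
      by (simp add: mult_ac)
  qed
  also have "\<dots> = C * (real R + \<mu>) ^ (k - 1)"
    by (simp add: binomial_ring sum_distrib_left)
  finally show ?thesis .
qed

definition link_count :: "'e \<Rightarrow> 'e list \<Rightarrow> real" where
  "link_count x xs = real (card {A\<in>link x. A \<subseteq> set xs})"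

lemma link_count_sum: "link_count x xs = (\<Sum>A\<in>link x. of_bool (A \<subseteq> set xs))"
  by (simp add: link_count_def sum.If_cases Int_def of_bool_def)

text \<open>Write one factor \<open>link_count x xs\<close> as a sum over \<open>A\<close> and
  absorb \<open>A\<close> into \<open>U\<close>; by \<open>link_sum_le\<close> each factor costs
  \<open>C * (real R + \<mu>) ^ (k - 1)\<close>. The set \<open>U\<close> is there for the
  induction, and \<open>R\<close> bounds all unions that it produces.\<close>

lemma link_count_moment:
  assumes "x \<in> E" "finite U" "card U + r * (k - 1) \<le> R" "real m / N \<le> \<mu> * q"
  shows "expect m (\<lambda>xs. of_bool (U \<subseteq> set xs) * link_count x xs ^ r) \<le>
           (C * (real R + \<mu>) ^ (k - 1)) ^ r * (real m / N) ^ card U"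
  using assms(2,3)
proof (induction r arbitrary: U)
  case 0
  then show ?case
    using expect_subset_le[of U m] by simp
next
  case (Suc r)
  let ?Q = "C * (real R + \<mu>) ^ (k - 1)" and ?p = "real m / N"
  have p: "?p \<ge> 0"
    by simp
  then have "0 \<le> \<mu> * q"
    using assms(4) by (rule order_trans)
  then have lam: "\<mu> \<ge> 0"
    using q_pos by (simp add: zero_le_mult_iff)
  have "expect m (\<lambda>xs. of_bool (U \<subseteq> set xs) * link_count x xs ^ Suc r) =
        expect m (\<lambda>xs. \<Sum>A\<in>link x. of_bool (U \<union> A \<subseteq> set xs) * link_count x xs ^ r)"
  proof (rule expect_cong)
    fix xs
    have "(\<Sum>A\<in>link x. of_bool (U \<union> A \<subseteq> set xs) * link_count x xs ^ r) =
          (\<Sum>A\<in>link x. of_bool (A \<subseteq> set xs)) * (of_bool (U \<subseteq> set xs) * link_count x xs ^ r)"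
      unfolding sum_distrib_right by (rule sum.cong) auto
    then show "of_bool (U \<subseteq> set xs) * link_count x xs ^ Suc r =
               (\<Sum>A\<in>link x. of_bool (U \<union> A \<subseteq> set xs) * link_count x xs ^ r)"
      by (simp only: link_count_sum[symmetric] power_Suc mult.left_commute)
  qed
  also have "\<dots> = (\<Sum>A\<in>link x. expect m (\<lambda>xs. of_bool (U \<union> A \<subseteq> set xs) * link_count x xs ^ r))"
    by (rule Bochner_Integration.integral_sum) simp
  also have "\<dots> \<le> (\<Sum>A\<in>link x. ?Q ^ r * ?p ^ card (U \<union> A))"
  proof (rule sum_mono)
    fix A assume A: "A \<in> link x"
    then have "card (U \<union> A) \<le> card U + (k - 1)"
      using card_Un_le[of U A] link_card by simp
    then show "expect m (\<lambda>xs. of_bool (U \<union> A \<subseteq> set xs) * link_count x xs ^ r) \<le> ?Q ^ r * ?p ^ card (U \<union> A)"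
      using Suc.prems finite_in_link[OF A] by (intro Suc.IH) auto
  qed
  also have "\<dots> = ?Q ^ r * ?p ^ card U * (\<Sum>A\<in>link x. ?p ^ card (A - U))"
  proof -
    have "?p ^ card (U \<union> A) = ?p ^ card U * ?p ^ card (A - U)" if "A \<in> link x" for A
      using card_Un_disjoint[of U "A - U"] Suc.prems(1) finite_in_link[OF that]
      by (simp add: power_add)
    then show ?thesis
      by (simp add: sum_distrib_left mult_ac)
  qed
  also have "\<dots> \<le> ?Q ^ r * ?p ^ card U * ?Q"
    using Suc.prems assms p lam C_pos by (intro mult_left_mono link_sum_le) auto
  finally show ?case
    by (simp add: mult_ac)
qed

end

text \<open>A geometric series with each term repeated \<open>b\<close> times.\<close>

lemma sum_power_div_le:
  fixes \<rho> :: real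
  assumes "0 \<le> \<rho>" "\<rho> < 1" "b > 0"
  shows "(\<Sum>i<m. \<rho> ^ (i div b)) \<le> real b / (1 - \<rho>)"
proof -
  have "(\<Sum>i<m. \<rho> ^ (i div b)) \<le> (\<Sum>i<m * b. \<rho> ^ (i div b))"
    using assms by (intro sum_mono2) auto
  also have "\<dots> = (\<Sum>j<m. \<Sum>i\<in>{j * b..<j * b + b}. \<rho> ^ (i div b))"
    by (rule sum.nat_group[symmetric])
  also have "\<dots> = (\<Sum>j<m. real b * \<rho> ^ j)"
  proof (rule sum.cong[OF refl])
    fix j
    have "i div b = j" if "i \<in> {j * b..<j * b + b}" for i
      using that assms(3) by (intro div_nat_eqI) (auto simp: mult.commute)
    then show "(\<Sum>i\<in>{j * b..<j * b + b}. \<rho> ^ (i div b)) = real b * \<rho> ^ j"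
      by simp
  qed
  also have "\<dots> = real b * ((1 - \<rho> ^ m) / (1 - \<rho>))"
    using assms by (simp add: sum_distrib_left[symmetric] sum_gp_strict)
  also have "\<dots> \<le> real b * (1 / (1 - \<rho>))"
    using assms by (intro mult_left_mono divide_right_mono) auto
  finally show ?thesis
    by simp
qed

section \<open>Probability of being closed, and the mean number of kept samples\<close>

context regular_hypergraph
begin

text \<open>One batch of about \<open>N * q\<close> samples for each of the \<open>k - 1\<close>
  elements of a link set, as \<open>expect_subset_ge\<close> requires.\<close>

definition block :: nat where
  "block = (k - 1) * nat \<lceil>N * q\<rceil>"

text \<open>Squared first moment over second moment of \<open>link_count\<close> on one block: the
  first is at least \<open>c / 2 ^ (k - 1)\<close>, the second at most
  \<open>(C * (7 * real k) ^ (k - 1))\<^sup>2\<close>.\<close>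

definition \<delta> :: real where
  "\<delta> = (c / 2 ^ (k - 1) / (C * (7 * real k) ^ (k - 1)))\<^sup>2"

lemma Nq_pos: "N * q > 0"
  using q_pos N_pos by simp

lemma block_pos: "block > 0"
  using k_ge_2 Nq_pos by (simp add: block_def)

text \<open>Rounding up adds at most 1, which is at most \<open>4 * (N * q)\<close> by
  \<open>Nq_ge\<close>.\<close>

lemma block_le: "real block \<le> 5 * real k * (N * q)"
proof -
  have "real (nat \<lceil>N * q\<rceil>) \<le> N * q + 1"
    using Nq_pos by linarith
  also have "\<dots> \<le> 5 * (N * q)"
    using Nq_ge by linarith
  finally have "real (k - 1) * real (nat \<lceil>N * q\<rceil>) \<le> real k * (5 * (N * q))"
    by (intro mult_mono) auto
  then show ?thesis
    by (simp add: block_def mult_ac)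
qed

lemma \<delta>_pos: "\<delta> > 0"
  using c_pos C_pos k_ge_2 by (simp add: \<delta>_def)

lemma expect_link_count:
  "expect m (link_count x) = (\<Sum>A\<in>link x. expect m (\<lambda>xs. of_bool (A \<subseteq> set xs)))"
  unfolding link_count_sum by (rule Bochner_Integration.integral_sum) simp

text \<open>Second moment method: \<open>[Z > 0] \<ge> 2 t Z - t\<^sup>2 Z\<^sup>2\<close> for every real \<open>t\<close>.\<close>

lemma expect_closed_ge:
  assumes "x \<in> E"
  shows "\<delta> \<le> expect block (\<lambda>xs. of_bool (closed_by \<F> x (set xs)))"
proof -
  define \<alpha> where "\<alpha> = c / 2 ^ (k - 1)"
  define Q where "Q = C * (7 * real k) ^ (k - 1)"
  \<comment> \<open>This \<open>t\<close> maximises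
    \<open>2 * t * \<alpha> - t\<^sup>2 * Q\<^sup>2\<close>; the maximum is \<delta>.\<close>
  define t where "t = \<alpha> / Q\<^sup>2"
  have Q: "Q > 0" and t: "t > 0"
    using C_pos c_pos k_ge_2 by (simp_all add: Q_def t_def \<alpha>_def)
  have "\<alpha> = c * (1 / q) ^ (k - 1) * (q / 2) ^ (k - 1)"
    using q_pos by (simp add: \<alpha>_def power_divide)
  also have "\<dots> \<le> real (card (link x)) * (q / 2) ^ (k - 1)"
    using card_link_ge[OF assms] q_pos by (intro mult_right_mono) auto
  also have "\<dots> = (\<Sum>A\<in>link x. (q / 2) ^ card A)"
    by (simp add: link_card)
  also have "\<dots> \<le> expect block (link_count x)"
    unfolding expect_link_count
  proof (rule sum_mono)
    fix A assume "A \<in> link x"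
    then show "(q / 2) ^ card A \<le> expect block (\<lambda>xs. of_bool (A \<subseteq> set xs))"
      using expect_subset_ge[OF link_subset, of A x q "nat \<lceil>N * q\<rceil>"] q_pos q_le_1
      by (simp add: link_card block_def)
  qed
  finally have first: "\<alpha> \<le> expect block (link_count x)" .
  have "real block / N \<le> 5 * real k * q"
    using block_le N_pos by (simp add: field_simps)
  \<comment> \<open>Two link sets have at most \<open>2 * k\<close> elements, so
    \<open>R = 2 * k\<close>; together with \<open>\<mu> = 5 * k\<close> from
    \<open>block_le\<close> this makes \<open>7 * k\<close>.\<close>
  then have "expect block (\<lambda>xs. of_bool ({} \<subseteq> set xs) * link_count x xs ^ 2) \<le>
        (C * (real (2 * k) + 5 * real k) ^ (k - 1)) ^ 2 * (real block / N) ^ card ({} :: 'e set)"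
    using assms by (intro link_count_moment) auto
  then have second: "expect block (\<lambda>xs. link_count x xs ^ 2) \<le> Q\<^sup>2"
    by (simp add: Q_def algebra_simps)
  have "\<delta> = 2 * t * \<alpha> - t\<^sup>2 * Q\<^sup>2"
  proof -
    have "\<delta> = (\<alpha> / Q)\<^sup>2"
      by (simp only: \<delta>_def \<alpha>_def Q_def)
    then show ?thesis
      using Q by (simp add: t_def field_simps power2_eq_square)
  qed
  also have "\<dots> \<le> 2 * t * expect block (link_count x) - t\<^sup>2 * expect block (\<lambda>xs. link_count x xs ^ 2)"
    using first second t by (intro diff_mono mult_left_mono) auto
  also have "\<dots> = expect block (\<lambda>xs. 2 * t * link_count x xs - t\<^sup>2 * link_count x xs ^ 2)"
    by simp
  also have "\<dots> \<le> expect block (\<lambda>xs. of_bool (closed_by \<F> x (set xs)))"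
  proof (rule expect_mono)
    fix xs
    show "2 * t * link_count x xs - t\<^sup>2 * link_count x xs ^ 2 \<le> of_bool (closed_by \<F> x (set xs))"
    proof (cases "closed_by \<F> x (set xs)")
      case True
      have "0 \<le> (1 - t * link_count x xs)\<^sup>2"
        by simp
      then show ?thesis
        using True by (simp add: power2_eq_square algebra_simps)
    next
      case False
      then have "{A\<in>link x. A \<subseteq> set xs} = {}"
        unfolding closed_by_link by blast
      then show ?thesis
        by (simp only: link_count_def) simp
    qed
  qed
  finally show ?thesis .
qed

lemma expect_not_closed_block:
  assumes "x \<in> E"
  shows "expect block (\<lambda>xs. of_bool (\<not> closed_by \<F> x (set xs))) \<le> 1 - \<delta>"
proof -
  have "expect block (\<lambda>xs. of_bool (\<not> closed_by \<F> x (set xs))) =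
        expect block (\<lambda>xs. 1 - of_bool (closed_by \<F> x (set xs)))"
    by (rule expect_cong) simp
  also have "\<dots> = 1 - expect block (\<lambda>xs. of_bool (closed_by \<F> x (set xs)))"
    by (subst Bochner_Integration.integral_diff) auto
  finally show ?thesis
    using expect_closed_ge[OF assms] by simp
qed

lemma \<delta>_le_1: "\<delta> \<le> 1"
proof -
  obtain x where "x \<in> E"
    using E_nonempty by blast
  have "0 \<le> expect block (\<lambda>xs. of_bool (\<not> closed_by \<F> x (set xs)))"
    by (rule expect_nonneg) simp
  also have "\<dots> \<le> 1 - \<delta>"
    using \<open>x \<in> E\<close> by (rule expect_not_closed_block)
  finally show ?thesis
    by simp
qed

text \<open>A concatenation closes whatever one of its parts closes, so each of the \<open>j\<close>
  independent blocks has to fail.\<close>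

lemma expect_not_closed_blocks:
  assumes "x \<in> E"
  shows "expect (j * block) (\<lambda>xs. of_bool (\<not> closed_by \<F> x (set xs))) \<le> (1 - \<delta>) ^ j"
proof (induction j)
  case (Suc j)
  let ?f = "\<lambda>xs. of_bool (\<not> closed_by \<F> x (set xs)) :: real"
  have "expect (Suc j * block) ?f = expect block (\<lambda>xs. expect (j * block) (\<lambda>ys. ?f (xs @ ys)))"
    unfolding mult_Suc by (rule expect_add)
  also have "\<dots> \<le> expect block (\<lambda>xs. expect (j * block) (\<lambda>ys. ?f xs * ?f ys))"
    by (intro expect_mono) (auto intro: closed_by_mono)
  also have "\<dots> = expect block ?f * expect (j * block) ?f"
    by simp
  also have "\<dots> \<le> (1 - \<delta>) * (1 - \<delta>) ^ j"
    using Suc expect_not_closed_block[OF assms] \<delta>_le_1 by (intro mult_mono expect_nonneg) auto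
  finally show ?case
    by simp
qed simp

lemma expect_not_closed:
  assumes "x \<in> E"
  shows "expect m (\<lambda>xs. of_bool (\<not> closed_by \<F> x (set xs))) \<le> (1 - \<delta>) ^ (m div block)"
proof -
  let ?f = "\<lambda>xs. of_bool (\<not> closed_by \<F> x (set xs)) :: real" and ?j = "m div block"
  have "expect m ?f = expect (?j * block + m mod block) ?f"
    by simp
  also have "\<dots> = expect (?j * block) (\<lambda>xs. expect (m mod block) (\<lambda>ys. ?f (xs @ ys)))"
    by (rule expect_add)
  also have "\<dots> \<le> expect (?j * block) (\<lambda>xs. expect (m mod block) (\<lambda>ys. ?f xs))"
    by (intro expect_mono) (auto intro: closed_by_mono)
  also have "\<dots> = expect (?j * block) ?f"
    by simp
  finally show ?thesis
    using expect_not_closed_blocks[OF assms, of ?j] by simp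
qed

lemma expect_kept_le: "expect m (\<lambda>xs. real (kept \<F> xs)) \<le> real block / \<delta>"
proof -
  have "expect m (\<lambda>xs. real (kept \<F> xs)) \<le> (\<Sum>i<m. (\<Sum>x\<in>E. (1 - \<delta>) ^ (i div block)) / N)"
    unfolding expect_kept by (intro sum_mono divide_right_mono expect_not_closed) auto
  also have "\<dots> = (\<Sum>i<m. (1 - \<delta>) ^ (i div block))"
    using N_pos by simp
  also have "\<dots> \<le> real block / (1 - (1 - \<delta>))"
    using \<delta>_pos \<delta>_le_1 block_pos by (intro sum_power_div_le) auto
  finally show ?thesis
    by simp
qed

text \<open>Solves \<open>(1 + C) * \<epsilon> = 1 / 2\<close>, which is what the union bound in
  \<open>expect_closed_le\<close> needs.\<close>

definition \<epsilon> :: real where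
  "\<epsilon> = 1 / (2 * (1 + C))"

text \<open>Union bound: either \<open>x\<close> itself was sampled, with probability at most
  \<epsilon>, or one of its link sets was completed, with probability at most
  \<open>C * \<epsilon> ^ (k - 1) \<le> C * \<epsilon>\<close>.\<close>

lemma expect_closed_le:
  assumes "x \<in> E" "real m \<le> \<epsilon> * (N * q)"
  shows "expect m (\<lambda>xs. of_bool (closed_by \<F> x (set xs))) \<le> 1 / 2"
proof -
  let ?p = "real m / N"
  have eps: "0 < \<epsilon>" "\<epsilon> \<le> 1"
    using C_pos by (simp_all add: \<epsilon>_def field_simps)
  have p: "0 \<le> ?p" "?p \<le> \<epsilon> * q"
    using assms(2) N_pos by (simp_all add: field_simps)
  have pe: "?p \<le> \<epsilon>"
    using p(2) q_le_1 eps mult_left_mono[of q 1 \<epsilon>] by linarith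
  have "expect m (\<lambda>xs. of_bool (closed_by \<F> x (set xs))) \<le>
        expect m (\<lambda>xs. of_bool ({x} \<subseteq> set xs) + link_count x xs)"
  proof (rule expect_mono)
    fix xs
    show "of_bool (closed_by \<F> x (set xs)) \<le> of_bool ({x} \<subseteq> set xs) + link_count x xs"
    proof (cases "\<exists>A\<in>link x. A \<subseteq> set xs")
      case True
      then have "card {A\<in>link x. A \<subseteq> set xs} > 0"
        by (subst card_gt_0_iff) auto
      then have "1 \<le> link_count x xs"
        by (simp add: link_count_def)
      moreover have "of_bool (closed_by \<F> x (set xs)) \<le> (1 :: real)"
        by simp
      ultimately show ?thesis
        by (simp add: add_increasing)
    qed (auto simp: closed_by_link link_count_def)
  qed
  also have "\<dots> = expect m (\<lambda>xs. of_bool ({x} \<subseteq> set xs)) + expect m (link_count x)"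
    by (rule Bochner_Integration.integral_add) simp_all
  also have "\<dots> \<le> ?p ^ card {x} + (\<Sum>A\<in>link x. ?p ^ card A)"
    unfolding expect_link_count
    by (intro add_mono sum_mono expect_subset_le) (auto intro: finite_in_link)
  also have "\<dots> = ?p + real (card (link x)) * ?p ^ (k - 1)"
    by (simp add: link_card)
  also have "real (card (link x)) * ?p ^ (k - 1) \<le> (C * (1 / q) ^ (k - 1)) * (\<epsilon> * q) ^ (k - 1)"
    using card_link_superset_le[of x "{}"] assms(1) p C_pos q_pos by (intro mult_mono power_mono) auto
  also have "\<dots> = C * \<epsilon> ^ (k - 1)"
    using q_pos by (simp add: power_mult_distrib power_divide)
  also have "\<epsilon> ^ (k - 1) \<le> \<epsilon> ^ 1"
    using eps k_ge_2 by (intro power_decreasing) auto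
  finally have "expect m (\<lambda>xs. of_bool (closed_by \<F> x (set xs))) \<le> \<epsilon> + C * \<epsilon>"
    using pe C_pos by simp
  also have "\<dots> = (1 + C) * \<epsilon>"
    by (simp add: distrib_right)
  also have "\<dots> = 1 / 2"
    using C_pos by (simp add: \<epsilon>_def)
  finally show ?thesis .
qed

text \<open>Each of the samples added up to time \<open>\<epsilon> * (N * q)\<close> is kept with
  probability at least one half.\<close>

lemma expect_kept_ge: "\<epsilon> * (N * q) / 2 \<le> expect (nat \<lceil>\<epsilon> * (N * q)\<rceil>) (\<lambda>xs. real (kept \<F> xs))"
proof -
  let ?m = "nat \<lceil>\<epsilon> * (N * q)\<rceil>"
  have half: "1 / 2 \<le> expect i (\<lambda>xs. of_bool (\<not> closed_by \<F> x (set xs)))"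
    if "x \<in> E" "i < ?m" for i x
  proof -
    have "real i \<le> \<epsilon> * (N * q)"
      using that(2) by linarith
    then have "1 / 2 \<le> 1 - expect i (\<lambda>xs. of_bool (closed_by \<F> x (set xs)))"
      using expect_closed_le[OF that(1), of i] by simp
    also have "\<dots> = expect i (\<lambda>xs. 1 - of_bool (closed_by \<F> x (set xs)))"
      by (subst Bochner_Integration.integral_diff) auto
    also have "\<dots> = expect i (\<lambda>xs. of_bool (\<not> closed_by \<F> x (set xs)))"
      by (rule expect_cong) simp
    finally show ?thesis .
  qed
  have "\<epsilon> * (N * q) / 2 \<le> (\<Sum>i<?m. (\<Sum>x\<in>E. 1 / 2) / N)"
    using N_pos by simp linarith
  also have "\<dots> \<le> expect ?m (\<lambda>xs. real (kept \<F> xs))"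
    unfolding expect_kept using half by (intro sum_mono divide_right_mono) auto
  finally show ?thesis .
qed

subsection \<open>The expected number of kept elements\<close>

abbreviation kept_pmf :: "nat pmf" where
  "kept_pmf \<equiv> map_pmf (kept \<F>) (pmf_of_set (permutations_of_set E))"

abbreviation M :: real where
  "M \<equiv> measure_pmf.expectation kept_pmf real"

text \<open>The number \<open>m\<close> of samples is free on the right: later bounds choose it to
  suit or let it grow.\<close>

lemma expectation_kept_pmf:
  fixes h :: "nat \<Rightarrow> real"
  shows "measure_pmf.expectation kept_pmf h =
    (\<Sum>ys\<in>permutations_of_set E. expect m (\<lambda>xs. h (kept \<F> (ys @ xs)))) / card (permutations_of_set E)"
proof -
  have "measure_pmf.expectation kept_pmf h =
    measure_pmf.expectation (bind_pmf (pmf_of_set (permutations_of_set E))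
       (\<lambda>ys. map_pmf (\<lambda>xs. kept \<F> (ys @ xs)) (samples m))) h"
    by (subst kept_permutation_samples[of E \<F> m]) auto
  also have "\<dots> = (\<Sum>ys\<in>permutations_of_set E.
      measure_pmf.expectation (map_pmf (\<lambda>xs. kept \<F> (ys @ xs)) (samples m)) h /\<^sub>R
        real (card (permutations_of_set E)))"
    by (subst pmf_expectation_bind_pmf_of_set) auto
  finally show ?thesis
    by (simp add: divide_inverse mult.commute sum_distrib_left)
qed

lemma expectation_kept_pmf_le:
  assumes "\<And>ys. ys \<in> permutations_of_set E \<Longrightarrow> expect m (\<lambda>xs. h (kept \<F> (ys @ xs))) \<le> u"
  shows "measure_pmf.expectation kept_pmf h \<le> u"
proof -
  have "card (permutations_of_set E) > 0"
    by (subst card_gt_0_iff) auto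
  moreover have "(\<Sum>ys\<in>permutations_of_set E. expect m (\<lambda>xs. h (kept \<F> (ys @ xs)))) \<le>
                   (\<Sum>ys\<in>permutations_of_set E. u)"
    using assms by (rule sum_mono)
  ultimately show ?thesis
    unfolding expectation_kept_pmf[of h m] by (simp add: field_simps)
qed

lemma expectation_kept_pmf_ge:
  assumes "\<And>ys. ys \<in> permutations_of_set E \<Longrightarrow> u \<le> expect m (\<lambda>xs. h (kept \<F> (ys @ xs)))"
  shows "u \<le> measure_pmf.expectation kept_pmf h"
proof -
  have "measure_pmf.expectation kept_pmf (\<lambda>j. - h j) \<le> - u"
    by (rule expectation_kept_pmf_le[of m]) (use assms in simp)
  then show ?thesis
    by simp
qed

abbreviation unsaturated :: "'e list \<Rightarrow> bool" where
  "unsaturated xs \<equiv> \<exists>x\<in>E. \<not> closed_by \<F> x (set xs)"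

lemma expect_unsaturated: "expect m (\<lambda>xs. of_bool (unsaturated xs)) \<le> N * (1 - \<delta>) ^ (m div block)"
proof -
  have "expect m (\<lambda>xs. of_bool (unsaturated xs)) \<le>
        expect m (\<lambda>xs. \<Sum>x\<in>E. of_bool (\<not> closed_by \<F> x (set xs)))"
  proof (rule expect_mono)
    fix xs
    show "of_bool (unsaturated xs) \<le> (\<Sum>x\<in>E. of_bool (\<not> closed_by \<F> x (set xs)) :: real)"
    proof (cases "unsaturated xs")
      case True
      then obtain x where "x \<in> E" "\<not> closed_by \<F> x (set xs)"
        by blast
      then show ?thesis
        using member_le_sum[of x E "\<lambda>x. of_bool (\<not> closed_by \<F> x (set xs)) :: real"] by simp
    qed (simp add: sum_nonneg)
  qed
  also have "\<dots> = (\<Sum>x\<in>E. expect m (\<lambda>xs. of_bool (\<not> closed_by \<F> x (set xs))))"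
    by (rule Bochner_Integration.integral_sum) simp
  also have "\<dots> \<le> (\<Sum>x\<in>E. (1 - \<delta>) ^ (m div block))"
    by (intro sum_mono expect_not_closed)
  finally show ?thesis
    by simp
qed

lemma kept_append_ge: "kept \<F> xs \<le> kept \<F> (ys @ xs)"
  by (induction ys) auto

lemma kept_append_le: "kept \<F> (ys @ xs) \<le> kept \<F> xs + length ys"
  by (induction ys) auto

lemma kept_append_saturated:
  assumes "\<not> unsaturated xs" "set ys \<subseteq> E"
  shows "kept \<F> (ys @ xs) = kept \<F> xs"
  using assms(2)
proof (induction ys)
  case (Cons y ys)
  then have "closed_by \<F> y (set (ys @ xs))"
    using assms(1) closed_by_mono[of \<F> y "set xs" "set (ys @ xs)"] by auto
  then show ?case
    using Cons by simp
qed simp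

lemma M_ge_expect_kept: "expect m (\<lambda>xs. real (kept \<F> xs)) \<le> M"
  by (rule expectation_kept_pmf_ge[of _ m]) (auto intro!: expect_mono kept_append_ge)

text \<open>The permutation in front adds nothing when the samples already close all of
  \<open>E\<close>, and at most \<open>N\<close> otherwise.\<close>

lemma M_le_expect_kept:
  "M \<le> expect m (\<lambda>xs. real (kept \<F> xs)) + N * (N * (1 - \<delta>) ^ (m div block))"
proof (rule expectation_kept_pmf_le[of m])
  fix ys assume "ys \<in> permutations_of_set E"
  then have ys: "set ys = E" "length ys = card E"
    using length_finite_permutations_of_set by (auto simp: permutations_of_setD)
  have "expect m (\<lambda>xs. real (kept \<F> (ys @ xs))) \<le>
        expect m (\<lambda>xs. real (kept \<F> xs) + N * of_bool (unsaturated xs))"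
  proof (rule expect_mono)
    fix xs
    show "real (kept \<F> (ys @ xs)) \<le> real (kept \<F> xs) + N * of_bool (unsaturated xs)"
      using kept_append_le[of ys xs] kept_append_saturated[of xs ys] ys
      by (cases "unsaturated xs") auto
  qed
  also have "\<dots> = expect m (\<lambda>xs. real (kept \<F> xs)) + N * expect m (\<lambda>xs. of_bool (unsaturated xs))"
    by (subst Bochner_Integration.integral_add) auto
  also have "\<dots> \<le> expect m (\<lambda>xs. real (kept \<F> xs)) + N * (N * (1 - \<delta>) ^ (m div block))"
    by (intro add_left_mono mult_left_mono expect_unsaturated) auto
  finally show "expect m (\<lambda>xs. real (kept \<F> (ys @ xs))) \<le> \<dots>" .
qed

lemma M_ge: "\<epsilon> * (N * q) / 2 \<le> M"
  using expect_kept_ge M_ge_expect_kept by (rule order_trans)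

lemma M_le: "M \<le> 5 * real k * (N * q) / \<delta>"
proof -
  \<comment> \<open>The bound on the kept samples does not depend on their number, so letting the
    number of blocks grow removes the error from unsaturated lists.\<close>
  have "(\<lambda>j. (1 - \<delta>) ^ j) \<longlonglongrightarrow> 0"
    by (rule LIMSEQ_realpow_zero) (use \<delta>_pos \<delta>_le_1 in auto)
  then have "(\<lambda>j. real block / \<delta> + N * (N * (1 - \<delta>) ^ j)) \<longlonglongrightarrow> real block / \<delta> + N * (N * 0)"
    by (intro tendsto_add tendsto_mult tendsto_const)
  moreover have "M \<le> real block / \<delta> + N * (N * (1 - \<delta>) ^ j)" for j
    using M_le_expect_kept[of "j * block"] expect_kept_le[of "j * block"] block_pos by simp
  ultimately have "M \<le> real block / \<delta> + N * (N * 0)"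
    by (intro LIMSEQ_le_const) auto
  also have "\<dots> \<le> 5 * real k * (N * q) / \<delta>"
    using block_le \<delta>_pos by (simp add: divide_right_mono)
  finally show ?thesis .
qed

end

subsection \<open>Bounded differences\<close>

context sampling
begin

lemma hoeffding_mean:
  fixes h :: "'e \<Rightarrow> real"
  assumes "s > 0" and "\<And>x y. x \<in> E \<Longrightarrow> y \<in> E \<Longrightarrow> \<bar>h x - h y\<bar> \<le> B"
  shows "(\<Sum>x\<in>E. exp (s * (h x - (\<Sum>x\<in>E. h x) / N))) / N \<le> exp (s\<^sup>2 * B\<^sup>2 / 8)"
proof -
  define a where "a = Min (h ` E)"
  have a: "a \<in> h ` E" "\<And>x. x \<in> E \<Longrightarrow> a \<le> h x"
    by (auto simp: a_def intro!: Min_in)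
  then have range: "h x \<in> {a..a + B}" if "x \<in> E" for x
    using assms(2)[of x] that by fastforce
  interpret interval_bounded_random_variable "measure_pmf (pmf_of_set E)" h a "a + B"
  proof unfold_locales
    show "AE x in measure_pmf (pmf_of_set E). h x \<in> {a..a + B}"
      by (rule AE_pmfI) (use range in \<open>simp only: set_pmf_of_set finite_E E_nonempty not_False_eq_True\<close>)
  qed simp
  let ?\<mu> = "measure_pmf.expectation (pmf_of_set E) h"
  have "integral\<^sup>N (measure_pmf (pmf_of_set E)) (\<lambda>x. ennreal (exp (s * (h x - ?\<mu>)))) \<le>
          ennreal (exp (s\<^sup>2 * (a + B - a)\<^sup>2 / 8))"
    by (rule Hoeffdings_lemma_nn_integral) (rule assms(1))
  also have "integral\<^sup>N (measure_pmf (pmf_of_set E)) (\<lambda>x. ennreal (exp (s * (h x - ?\<mu>)))) =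
          ennreal (measure_pmf.expectation (pmf_of_set E) (\<lambda>x. exp (s * (h x - ?\<mu>))))"
    by (intro nn_integral_eq_integral integrable_measure_pmf_finite) auto
  finally have "measure_pmf.expectation (pmf_of_set E) (\<lambda>x. exp (s * (h x - ?\<mu>))) \<le> exp (s\<^sup>2 * B\<^sup>2 / 8)"
    by simp
  then show ?thesis
    by (simp add: integral_pmf_of_set)
qed

definition bounded_differences :: "nat \<Rightarrow> real \<Rightarrow> ('e list \<Rightarrow> real) \<Rightarrow> bool" where
  "bounded_differences m B g \<longleftrightarrow>
     (\<forall>xs i y. length xs = m \<and> set xs \<subseteq> E \<and> i < m \<and> y \<in> E \<longrightarrow> \<bar>g (xs[i := y]) - g xs\<bar> \<le> B)"

text \<open>Reveal the samples one at a time. The conditional mean \<open>h\<close> given the first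
  one oscillates by at most \<open>B\<close>, so Hoeffding's lemma yields one factor; the induction
  hypothesis, applied with the first sample fixed, yields the others.\<close>

lemma bounded_differences_mgf:
  assumes "s > 0" "bounded_differences m B g"
  shows "expect m (\<lambda>xs. exp (s * (g xs - expect m g))) \<le> exp (real m * (s\<^sup>2 * B\<^sup>2 / 8))"
  using assms(2)
proof (induction m arbitrary: g)
  case (Suc m)
  define h where "h x = expect m (\<lambda>xs. g (x # xs))" for x
  let ?b = "s\<^sup>2 * B\<^sup>2 / 8"
  have mean: "expect (Suc m) g = (\<Sum>x\<in>E. h x) / N"
    by (simp only: expect_Suc h_def)
  have diff: "\<bar>h x - h y\<bar> \<le> B" if "x \<in> E" "y \<in> E" for x y
  proof -
    have "h x - h y = expect m (\<lambda>xs. g (x # xs) - g (y # xs))"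
      by (simp add: h_def)
    moreover have "\<bar>g (x # xs) - g (y # xs)\<bar> \<le> B" if "length xs = m" "set xs \<subseteq> E" for xs
      using Suc.prems[unfolded bounded_differences_def, rule_format, of "y # xs" 0 x] that \<open>x \<in> E\<close> \<open>y \<in> E\<close>
      by simp
    then have "expect m (\<lambda>xs. g (x # xs) - g (y # xs)) \<le> expect m (\<lambda>_. B)"
      and "expect m (\<lambda>_. - B) \<le> expect m (\<lambda>xs. g (x # xs) - g (y # xs))"
      by (intro expect_mono; fastforce)+
    ultimately show ?thesis
      by (simp add: abs_le_iff)
  qed
  have IH: "expect m (\<lambda>xs. exp (s * (g (x # xs) - h x))) \<le> exp (real m * ?b)" if "x \<in> E" for x
    unfolding h_def
  proof (rule Suc.IH)
    show "bounded_differences m B (\<lambda>xs. g (x # xs))"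
      unfolding bounded_differences_def
    proof (intro allI impI)
      fix xs i y assume "length xs = m \<and> set xs \<subseteq> E \<and> i < m \<and> y \<in> E"
      then show "\<bar>g (x # xs[i := y]) - g (x # xs)\<bar> \<le> B"
        using Suc.prems[unfolded bounded_differences_def, rule_format, of "x # xs" "Suc i" y] that by simp
    qed
  qed
  have "expect (Suc m) (\<lambda>xs. exp (s * (g xs - expect (Suc m) g))) =
    (\<Sum>x\<in>E. expect m (\<lambda>xs. exp (s * (g (x # xs) - (\<Sum>x\<in>E. h x) / N)))) / N"
    by (simp only: mean) (simp only: expect_Suc)
  also have "\<dots> = (\<Sum>x\<in>E. exp (s * (h x - (\<Sum>x\<in>E. h x) / N)) *
                       expect m (\<lambda>xs. exp (s * (g (x # xs) - h x)))) / N"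
    by (simp add: exp_add[symmetric] algebra_simps flip: integral_mult_right_zero)
  also have "\<dots> \<le> (\<Sum>x\<in>E. exp (s * (h x - (\<Sum>x\<in>E. h x) / N)) * exp (real m * ?b)) / N"
    using IH by (intro divide_right_mono sum_mono mult_left_mono) auto
  also have "\<dots> = (\<Sum>x\<in>E. exp (s * (h x - (\<Sum>x\<in>E. h x) / N))) / N * exp (real m * ?b)"
    by (simp add: sum_distrib_right)
  also have "\<dots> \<le> exp ?b * exp (real m * ?b)"
    by (intro mult_right_mono hoeffding_mean[OF assms(1) diff]) auto
  also have "\<dots> = exp (real (Suc m) * ?b)"
    by (simp add: exp_add[symmetric] algebra_simps)
  finally show ?case .
qed simp

lemma bounded_differences_upper_tail:
  assumes "bounded_differences m B g" "m > 0" "B > 0" "t > 0"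
  shows "expect m (\<lambda>xs. of_bool (g xs - expect m g \<ge> t)) \<le> exp (- (2 * t\<^sup>2 / (real m * B\<^sup>2)))"
proof -
  \<comment> \<open>The minimiser of the exponent
    \<open>real m * (s\<^sup>2 * B\<^sup>2 / 8) - s * t\<close>.\<close>
  define s where "s = 4 * t / (real m * B\<^sup>2)"
  have s: "s > 0"
    using assms by (simp add: s_def)
  have "expect m (\<lambda>xs. of_bool (g xs - expect m g \<ge> t)) \<le>
        expect m (\<lambda>xs. exp (- (s * t)) * exp (s * (g xs - expect m g)))"
  proof (rule expect_mono)
    fix xs
    have "s * t \<le> s * (g xs - expect m g)" if "t \<le> g xs - expect m g"
      using that s by (intro mult_left_mono) auto
    then show "of_bool (g xs - expect m g \<ge> t) \<le> exp (- (s * t)) * exp (s * (g xs - expect m g))"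
      by (simp add: exp_add[symmetric])
  qed
  also have "\<dots> = exp (- (s * t)) * expect m (\<lambda>xs. exp (s * (g xs - expect m g)))"
    by simp
  also have "\<dots> \<le> exp (- (s * t)) * exp (real m * (s\<^sup>2 * B\<^sup>2 / 8))"
    by (intro mult_left_mono bounded_differences_mgf s assms(1)) auto
  also have "\<dots> = exp (real m * (s\<^sup>2 * B\<^sup>2 / 8) - s * t)"
    by (simp add: exp_add[symmetric])
  also have "real m * (s\<^sup>2 * B\<^sup>2 / 8) - s * t = - (2 * t\<^sup>2 / (real m * B\<^sup>2))"
    using assms(2,3) by (simp add: s_def field_simps power2_eq_square)
  finally show ?thesis .
qed

lemma bounded_differences_uminus: "bounded_differences m B g \<Longrightarrow> bounded_differences m B (\<lambda>xs. - g xs)"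
  by (simp add: bounded_differences_def abs_minus_commute)

lemma bounded_differences_tail:
  assumes "bounded_differences m B g" "m > 0" "B > 0" "t > 0"
  shows "expect m (\<lambda>xs. of_bool (\<bar>g xs - expect m g\<bar> \<ge> t)) \<le> 2 * exp (- (2 * t\<^sup>2 / (real m * B\<^sup>2)))"
proof -
  have "expect m (\<lambda>xs. of_bool (\<bar>g xs - expect m g\<bar> \<ge> t)) \<le>
        expect m (\<lambda>xs. of_bool (g xs - expect m g \<ge> t) + of_bool (- g xs - expect m (\<lambda>xs. - g xs) \<ge> t))"
    by (rule expect_mono) auto
  also have "\<dots> = expect m (\<lambda>xs. of_bool (g xs - expect m g \<ge> t)) +
                   expect m (\<lambda>xs. of_bool (- g xs - expect m (\<lambda>xs. - g xs) \<ge> t))"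
    by (rule Bochner_Integration.integral_add) simp_all
  also have "\<dots> \<le> exp (- (2 * t\<^sup>2 / (real m * B\<^sup>2))) + exp (- (2 * t\<^sup>2 / (real m * B\<^sup>2)))"
    by (intro add_mono bounded_differences_upper_tail bounded_differences_uminus assms)
  finally show ?thesis
    by simp
qed

end

section \<open>Hamming distance and Lipschitz extension\<close>

primrec hamming :: "'e list \<Rightarrow> 'e list \<Rightarrow> nat" where
  "hamming [] ys = 0"
| "hamming (x # xs) ys =
     (case ys of [] \<Rightarrow> 0 | y # ys' \<Rightarrow> hamming xs ys' + (if x = y then 0 else 1))"

lemma hamming_refl [simp]: "hamming xs xs = 0"
  by (induction xs) auto

lemma hamming_le: "hamming xs ys \<le> length xs"
  by (induction xs arbitrary: ys) (auto split: list.splits simp: le_SucI)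

lemma hamming_update:
  "hamming (xs[i := y]) zs \<le> hamming xs zs + 1 \<and> hamming xs zs \<le> hamming (xs[i := y]) zs + 1"
proof (induction xs arbitrary: i zs)
  case (Cons x xs)
  show ?case
  proof (cases zs)
    case Nil
    then show ?thesis
      by (cases i) auto
  next
    case (Cons z zs')
    then show ?thesis
      using Cons.IH[of "i - 1" zs'] by (cases i) auto
  qed
qed simp

text \<open>McShane's extension of a function that is \<open>B\<close>-Lipschitz on
  \<open>G\<close>.\<close>

definition lipschitz_extension :: "'e list set \<Rightarrow> real \<Rightarrow> ('e list \<Rightarrow> real) \<Rightarrow> 'e list \<Rightarrow> real" where
  "lipschitz_extension G B f xs = Min ((\<lambda>ys. f ys + B * real (hamming xs ys)) ` G)"

lemma lipschitz_extension_eq: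
  assumes "finite G" "xs \<in> G"
    and "\<And>ys. ys \<in> G \<Longrightarrow> f xs \<le> f ys + B * real (hamming xs ys)"
  shows "lipschitz_extension G B f xs = f xs"
  unfolding lipschitz_extension_def
proof (rule Min_eqI)
  show "f xs \<in> (\<lambda>ys. f ys + B * real (hamming xs ys)) ` G"
    using assms(2) by (force intro: image_eqI[where x = xs])
qed (use assms in auto)

lemma lipschitz_extension_le:
  assumes "finite G" "G \<noteq> {}" "B \<ge> 0"
    and "\<And>zs. zs \<in> G \<Longrightarrow> hamming xs zs \<le> hamming ys zs + 1"
  shows "lipschitz_extension G B f xs \<le> lipschitz_extension G B f ys + B"
proof -
  have "lipschitz_extension G B f ys \<in> (\<lambda>zs. f zs + B * real (hamming ys zs)) ` G"
    unfolding lipschitz_extension_def using assms by (intro Min_in) auto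
  then obtain zs where zs: "zs \<in> G" "lipschitz_extension G B f ys = f zs + B * real (hamming ys zs)"
    by blast
  have "lipschitz_extension G B f xs \<le> f zs + B * real (hamming xs zs)"
    unfolding lipschitz_extension_def using assms zs by (intro Min_le) auto
  also have "\<dots> \<le> f zs + B * (real (hamming ys zs) + 1)"
  proof (intro add_left_mono mult_left_mono)
    show "real (hamming xs zs) \<le> real (hamming ys zs) + 1"
      using assms(4)[OF zs(1)] by linarith
  qed (rule assms(3))
  finally show ?thesis
    using zs by (simp add: algebra_simps)
qed

lemma (in sampling) bounded_differences_lipschitz_extension:
  assumes "finite G" "G \<noteq> {}" "B \<ge> 0"
  shows "bounded_differences m B (lipschitz_extension G B f)"
  unfolding bounded_differences_def
proof (intro allI impI)
  fix xs :: "'e list" and i :: nat and y :: 'e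
  have "lipschitz_extension G B f (xs[i := y]) \<le> lipschitz_extension G B f xs + B"
    and "lipschitz_extension G B f xs \<le> lipschitz_extension G B f (xs[i := y]) + B"
    using hamming_update[of xs i y] by (auto intro!: lipschitz_extension_le assms)
  then show "\<bar>lipschitz_extension G B f (xs[i := y]) - lipschitz_extension G B f xs\<bar> \<le> B"
    by linarith
qed

subsection \<open>Concentration\<close>

text \<open>Serves as a stopover between two lists: its entries occur in both, so it is sparse
  whenever one of them is.\<close>

primrec agreement :: "'e list \<Rightarrow> 'e list \<Rightarrow> 'e list" where
  "agreement [] ys = []"
| "agreement (x # xs) ys =
     (case ys of [] \<Rightarrow> [] | y # ys' \<Rightarrow> if x = y then x # agreement xs ys' else agreement xs ys')"

lemma agreement_commute: "length xs = length ys \<Longrightarrow> agreement xs ys = agreement ys xs"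
  by (induction xs ys rule: list_induct2) auto

lemma hamming_commute: "length xs = length ys \<Longrightarrow> hamming xs ys = hamming ys xs"
  by (induction xs ys rule: list_induct2) auto

lemma kept_le_length: "kept \<F> xs \<le> length xs"
  by (induction xs) auto

context regular_hypergraph
begin

definition sparse :: "real \<Rightarrow> 'e set \<Rightarrow> bool" where
  "sparse D S \<longleftrightarrow> (\<forall>x\<in>E. real (card {A\<in>link x. A \<subseteq> S}) \<le> D)"

lemma sparse_mono:
  assumes "sparse D T" "S \<subseteq> T"
  shows "sparse D S"
  unfolding sparse_def
proof
  fix x assume "x \<in> E"
  have "card {A\<in>link x. A \<subseteq> S} \<le> card {A\<in>link x. A \<subseteq> T}"
    using assms(2) by (intro card_mono) auto
  then show "real (card {A\<in>link x. A \<subseteq> S}) \<le> D"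
    using assms(1) \<open>x \<in> E\<close> unfolding sparse_def by (meson of_nat_mono order_trans)
qed

text \<open>An extra entry can only close more of the entries before it, so the only possible gain
  is \<open>x\<close> itself.\<close>

lemma kept_insert_le: "kept \<F> (as @ x # bs) \<le> kept \<F> (as @ bs) + 1"
proof (induction as)
  case (Cons a as)
  have "closed_by \<F> a (set (as @ bs)) \<Longrightarrow> closed_by \<F> a (set (as @ x # bs))"
    by (erule closed_by_mono) auto
  then show ?case
    using Cons by auto
qed auto

text \<open>An entry \<open>a\<close> of \<open>as\<close> that \<open>x\<close> causes to be lost
  either equals \<open>x\<close> or is closed by a member of \<F> through \<open>x\<close>, so that
  \<open>a\<close> lies in a link set of \<open>x\<close> inside \<open>W\<close>. Being kept
  before, \<open>a\<close> does not recur in the rest of \<open>as\<close>, so each element is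
  charged once. Fixing \<open>W\<close> keeps the charged set the same throughout the
  induction.\<close>

lemma kept_insert_ge:
  assumes "set (as @ x # bs) \<subseteq> W"
  shows "kept \<F> (as @ bs) \<le>
           kept \<F> (as @ x # bs) + card (set as \<inter> insert x (\<Union>{A\<in>link x. A \<subseteq> W}))"
  using assms
proof (induction as)
  case (Cons a as)
  let ?T = "insert x (\<Union>{A\<in>link x. A \<subseteq> W})"
  have IH: "kept \<F> (as @ bs) \<le> kept \<F> (as @ x # bs) + card (set as \<inter> ?T)"
    using Cons by simp
  have mono: "card (set as \<inter> ?T) \<le> card (set (a # as) \<inter> ?T)"
    by (rule card_mono) auto
  show ?case
  proof (cases "\<not> closed_by \<F> a (set (as @ bs)) \<and> closed_by \<F> a (set (as @ x # bs))")
    case False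
    then show ?thesis
      using IH mono by (auto split: if_splits)
  next
    case True
    have new: "a \<notin> set as"
      using True by (auto simp: closed_by_def)
    have "a \<in> ?T"
    proof (cases "a = x")
      case False
      then have "a \<notin> set (as @ x # bs)"
        using True by (auto simp: closed_by_def)
      then obtain F where F: "F \<in> \<F>" "a \<in> F" "F \<subseteq> insert a (set (as @ x # bs))"
        using True unfolding closed_by_def by blast
      have "x \<in> F"
      proof (rule ccontr)
        assume "x \<notin> F"
        then have "F \<subseteq> insert a (set (as @ bs))"
          using F(3) by auto
        then show False
          using True F unfolding closed_by_def by blast
      qed
      then have "F - {x} \<in> link x" "F - {x} \<subseteq> W" "a \<in> F - {x}"
        using F Cons.prems False by (auto simp: link_def insert_absorb)
      then show ?thesis
        by blast
    qed simp
    then have "set (a # as) \<inter> ?T = insert a (set as \<inter> ?T)"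
      by auto
    then have "card (set (a # as) \<inter> ?T) = Suc (card (set as \<inter> ?T))"
      using new by simp
    then show ?thesis
      using IH True by simp
  qed
qed simp

text \<open>Sparsity bounds the charged set of \<open>kept_insert_ge\<close>: \<open>x\<close> and
  at most \<open>D\<close> link sets of fewer than \<open>k\<close> elements.\<close>

lemma kept_insert_diff:
  assumes "sparse D (set (as @ x # bs))" "x \<in> E"
  shows "\<bar>real (kept \<F> (as @ x # bs)) - real (kept \<F> (as @ bs))\<bar> \<le> 1 + real k * D"
proof -
  let ?W = "set (as @ x # bs)"
  let ?L = "{A\<in>link x. A \<subseteq> ?W}"
  have D: "real (card ?L) \<le> D"
    using assms unfolding sparse_def by blast
  have "card (set as \<inter> insert x (\<Union>?L)) \<le> card (insert x (\<Union>?L))"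
    by (rule card_mono) (auto intro: finite_in_link)
  also have "\<dots> \<le> Suc (card (\<Union>?L))"
    by (rule card_insert_le_m1) auto
  also have "card (\<Union>?L) \<le> (\<Sum>A\<in>?L. card A)"
    by (rule card_Union_le_sum_card)
  also have "\<dots> \<le> (\<Sum>A\<in>?L. k)"
    by (rule sum_mono) (auto simp: link_card)
  finally have "real (card (set as \<inter> insert x (\<Union>?L))) \<le> 1 + real k * real (card ?L)"
    by (simp add: mult.commute flip: of_nat_mult of_nat_Suc)
  also have "\<dots> \<le> 1 + real k * D"
    using D by (intro add_left_mono mult_left_mono) auto
  finally have "real (kept \<F> (as @ bs)) \<le> real (kept \<F> (as @ x # bs)) + (1 + real k * D)"
    using kept_insert_ge[of as x bs ?W] by simp
  moreover have "0 \<le> real k * D"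
    using D by (intro mult_nonneg_nonneg) (auto intro: order_trans[rotated])
  ultimately show ?thesis
    using kept_insert_le[of as x bs] by simp
qed

text \<open>Delete the disagreeing entries of \<open>xs\<close> one by one from the left;
  \<open>as\<close> collects the entries already passed and retained. Sparsity survives every
  deletion, so each costs at most \<open>1 + real k * D\<close>.\<close>

lemma kept_agreement:
  assumes "length xs = length ys" "sparse D (set (as @ xs))" "set xs \<subseteq> E"
  shows "\<bar>real (kept \<F> (as @ xs)) - real (kept \<F> (as @ agreement xs ys))\<bar> \<le>
           (1 + real k * D) * real (hamming xs ys)"
  using assms
proof (induction xs ys arbitrary: as rule: list_induct2)
  case (Cons x xs y ys)
  show ?case
  proof (cases "x = y")
    case True
    then show ?thesis
      using Cons.IH[of "as @ [x]"] Cons.prems by simp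
  next
    case False
    have "sparse D (set (as @ xs))"
      using Cons.prems(1) by (rule sparse_mono) auto
    then have "\<bar>real (kept \<F> (as @ xs)) - real (kept \<F> (as @ agreement xs ys))\<bar> \<le>
            (1 + real k * D) * real (hamming xs ys)"
      using Cons.IH[of as] Cons.prems(2) by simp
    moreover have "\<bar>real (kept \<F> (as @ x # xs)) - real (kept \<F> (as @ xs))\<bar> \<le> 1 + real k * D"
      using Cons.prems by (intro kept_insert_diff) auto
    ultimately show ?thesis
      using False by (simp add: algebra_simps)
  qed
qed simp

text \<open>Go from \<open>xs\<close> down to the agreement and from there up to \<open>ys\<close>,
  whence the factor 2. Replacing entries directly could lead through lists that are not
  sparse.\<close>

lemma kept_lipschitz:
  assumes "length xs = length ys" "sparse D (set xs)" "sparse D (set ys)" "set xs \<subseteq> E" "set ys \<subseteq> E"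
  shows "\<bar>real (kept \<F> xs) - real (kept \<F> ys)\<bar> \<le> 2 * (1 + real k * D) * real (hamming xs ys)"
proof -
  let ?zs = "agreement xs ys" and ?u = "(1 + real k * D) * real (hamming xs ys)"
  have "\<bar>real (kept \<F> xs) - real (kept \<F> ?zs)\<bar> \<le> ?u"
    using kept_agreement[of xs ys D "[]"] assms by simp
  moreover have "\<bar>real (kept \<F> ys) - real (kept \<F> ?zs)\<bar> \<le> ?u"
    using kept_agreement[of ys xs D "[]"] assms
      agreement_commute[OF assms(1)] hamming_commute[OF assms(1)] by simp
  ultimately have "\<bar>real (kept \<F> xs) - real (kept \<F> ys)\<bar> \<le> 2 * ?u"
    by linarith
  then show ?thesis
    by (simp only: mult.assoc)
qed

text \<open>Markov's inequality for the \<open>r\<close>-th moment: it is at most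
  \<open>Q ^ r\<close>, so exceeding \<open>2 * Q\<close> has probability at most
  \<open>1 / 2 ^ r\<close> for each of the \<open>N\<close> elements.\<close>

lemma expect_not_sparse:
  fixes r :: nat
  assumes "real m / N \<le> \<mu> * q" "\<mu> > 0"
  defines "Q \<equiv> C * (real (r * k) + \<mu>) ^ (k - 1)"
  shows "expect m (\<lambda>xs. of_bool (\<not> sparse (2 * Q) (set xs))) \<le> N / 2 ^ r"
proof -
  have Q: "Q > 0"
    using C_pos assms(2) by (simp add: Q_def add_nonneg_pos)
  have single: "expect m (\<lambda>xs. of_bool (link_count x xs > 2 * Q)) \<le> 1 / 2 ^ r" if "x \<in> E" for x
  proof -
    have "expect m (\<lambda>xs. of_bool (link_count x xs > 2 * Q)) \<le>
          expect m (\<lambda>xs. (of_bool ({} \<subseteq> set xs) * link_count x xs ^ r) / (2 * Q) ^ r)"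
    proof (rule expect_mono)
      fix xs
      have "1 \<le> (link_count x xs / (2 * Q)) ^ r" if "link_count x xs > 2 * Q"
        using that Q by (intro one_le_power) simp
      then show "of_bool (link_count x xs > 2 * Q) \<le>
              (of_bool ({} \<subseteq> set xs) * link_count x xs ^ r) / (2 * Q) ^ r"
        using Q by (auto simp: power_divide link_count_def)
    qed
    also have "\<dots> = expect m (\<lambda>xs. of_bool ({} \<subseteq> set xs) * link_count x xs ^ r) / (2 * Q) ^ r"
      by simp
    also have "\<dots> \<le> (Q ^ r * (real m / N) ^ card ({} :: 'e set)) / (2 * Q) ^ r"
      unfolding Q_def
      by (intro divide_right_mono link_count_moment that assms(1)) (use C_pos assms(2) in auto)
    also have "\<dots> = 1 / 2 ^ r"
      using Q by (simp add: power_mult_distrib)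
    finally show ?thesis .
  qed
  have "expect m (\<lambda>xs. of_bool (\<not> sparse (2 * Q) (set xs))) \<le>
        expect m (\<lambda>xs. \<Sum>x\<in>E. of_bool (link_count x xs > 2 * Q))"
  proof (rule expect_mono)
    fix xs
    show "of_bool (\<not> sparse (2 * Q) (set xs)) \<le> (\<Sum>x\<in>E. of_bool (link_count x xs > 2 * Q) :: real)"
    proof (cases "sparse (2 * Q) (set xs)")
      case False
      then obtain x where "x \<in> E" "link_count x xs > 2 * Q"
        unfolding sparse_def link_count_def by force
      then show ?thesis
        using member_le_sum[of x E "\<lambda>x. of_bool (link_count x xs > 2 * Q) :: real"] by simp
    qed (simp add: sum_nonneg)
  qed
  also have "\<dots> = (\<Sum>x\<in>E. expect m (\<lambda>xs. of_bool (link_count x xs > 2 * Q)))"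
    by (rule Bochner_Integration.integral_sum) simp
  also have "\<dots> \<le> (\<Sum>x\<in>E. 1 / 2 ^ r)"
    by (intro sum_mono single)
  finally show ?thesis
    by simp
qed

text \<open>The three terms are the probabilities that the samples are unsaturated, that they are
  not sparse, and that the Lipschitz extension \<open>g\<close> of the kept count deviates. Outside
  the first two events the kept count equals \<open>g\<close>. The shift \<open>e1\<close> compares
  \<open>M\<close> with the mean over samples only, and \<open>e2\<close> compares that mean with
  the mean of \<open>g\<close>.\<close>

lemma kept_concentration:
  assumes "t > 0" "j > 0" "N / 2 ^ r < 1"
  defines "B \<equiv> 2 * (1 + real k * (2 * (C * (real (r * k) + 5 * real k * real j) ^ (k - 1))))"
    and "m \<equiv> j * block"
  defines "e1 \<equiv> N * (N * (1 - \<delta>) ^ j)" and "e2 \<equiv> real m * (1 + B) * (N / 2 ^ r)"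
  shows "measure_pmf.prob kept_pmf {v. \<bar>real v - M\<bar> > t + e1 + e2} \<le>
           N * (1 - \<delta>) ^ j + N / 2 ^ r + 2 * exp (- (2 * t\<^sup>2 / (real m * B\<^sup>2)))"
proof -
  define \<mu> where "\<mu> = 5 * real k * real j"
  define Q where "Q = C * (real (r * k) + \<mu>) ^ (k - 1)"
  define D where "D = 2 * Q"
  have mu: "\<mu> > 0" and m: "m > 0"
    using assms(2) k_ge_2 block_pos by (simp_all add: \<mu>_def m_def)
  have Q: "Q > 0"
    using C_pos mu by (simp add: Q_def add_nonneg_pos)
  have B: "B = 2 * (1 + real k * D)"
    by (simp add: B_def D_def Q_def \<mu>_def)
  then have B_pos: "B > 0"
    using Q k_ge_2 by (simp add: D_def add_pos_nonneg)
  have "real m / N \<le> \<mu> * q"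
    using mult_left_mono[OF block_le, of "real j"] N_pos by (simp add: m_def \<mu>_def field_simps)
  then have not_sparse: "expect m (\<lambda>xs. of_bool (\<not> sparse D (set xs))) \<le> N / 2 ^ r"
    unfolding D_def Q_def using mu by (rule expect_not_sparse)
  define f where "f xs = real (kept \<F> xs)" for xs
  define G where "G = {xs. length xs = m \<and> set xs \<subseteq> E \<and> sparse D (set xs)}"
  define g where "g = lipschitz_extension G B f"
  have finG: "finite G"
    by (rule finite_subset[OF _ finite_samples[of m]]) (auto simp: G_def set_samples)
  \<comment> \<open>Without any sparse list the failure probability would be 1, contrary to
    \<open>N / 2 ^ r < 1\<close>.\<close>
  have G_ne: "G \<noteq> {}"
  proof
    assume "G = {}"
    then have "expect m (\<lambda>xs. 1) \<le> expect m (\<lambda>xs. of_bool (\<not> sparse D (set xs)))"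
      by (intro expect_mono) (auto simp: G_def)
    then show False
      using not_sparse assms(3) by simp
  qed
  have bd: "bounded_differences m B g"
    unfolding g_def using finG G_ne B_pos by (intro bounded_differences_lipschitz_extension) auto
  have gf: "g xs = f xs" if "xs \<in> G" for xs
    unfolding g_def
  proof (rule lipschitz_extension_eq[OF finG that])
    fix ys assume "ys \<in> G"
    then show "f xs \<le> f ys + B * real (hamming xs ys)"
      using kept_lipschitz[of xs ys D] that unfolding G_def f_def B by auto
  qed
  have range_f: "0 \<le> f xs \<and> f xs \<le> real m" if "length xs = m" for xs
    using kept_le_length[of \<F> xs] that by (simp add: f_def)
  have range_g: "0 \<le> g xs \<and> g xs \<le> real m * (1 + B)" if "length xs = m" for xs
  proof -
    have "g xs \<in> (\<lambda>ys. f ys + B * real (hamming xs ys)) ` G"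
      unfolding g_def lipschitz_extension_def using finG G_ne by (intro Min_in) auto
    then obtain ys where ys: "ys \<in> G" "g xs = f ys + B * real (hamming xs ys)"
      by blast
    moreover have "B * real (hamming xs ys) \<le> B * real m"
      using hamming_le[of xs ys] that B_pos by (intro mult_left_mono) auto
    moreover have "0 \<le> B * real (hamming xs ys)"
      using B_pos by simp
    ultimately show ?thesis
      using range_f[of ys] by (auto simp: G_def algebra_simps)
  qed
  \<comment> \<open>The two functions differ on lists that are not sparse only, and both take values
    between 0 and \<open>real m * (1 + B)\<close>.\<close>
  have diff: "\<bar>f xs - g xs\<bar> \<le> real m * (1 + B) * of_bool (\<not> sparse D (set xs))"
    if "length xs = m" "set xs \<subseteq> E" for xs
  proof (cases "sparse D (set xs)")
    case True
    then show ?thesis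
      using gf[of xs] that by (simp add: G_def)
  next
    case False
    have "real m \<le> real m * (1 + B)"
      using B_pos by (simp add: algebra_simps)
    then show ?thesis
      using range_f[OF that(1)] range_g[OF that(1)] False by (simp add: abs_le_iff)
  qed
  have mean_fg: "\<bar>expect m f - expect m g\<bar> \<le> e2"
  proof -
    have "\<bar>expect m f - expect m g\<bar> = \<bar>expect m (\<lambda>xs. f xs - g xs)\<bar>"
      by simp
    also have "\<dots> \<le> expect m (\<lambda>xs. \<bar>f xs - g xs\<bar>)"
      by (rule integral_abs_bound)
    also have "\<dots> \<le> expect m (\<lambda>xs. real m * (1 + B) * of_bool (\<not> sparse D (set xs)))"
      by (rule expect_mono) (rule diff)
    also have "\<dots> = real m * (1 + B) * expect m (\<lambda>xs. of_bool (\<not> sparse D (set xs)))"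
      by simp
    also have "\<dots> \<le> e2"
      unfolding e2_def using not_sparse B_pos by (intro mult_left_mono) auto
    finally show ?thesis .
  qed
  have mean_f: "\<bar>M - expect m f\<bar> \<le> e1"
    using M_ge_expect_kept[of m] M_le_expect_kept[of m] block_pos
    unfolding f_def e1_def m_def by simp
  have "measure_pmf.prob kept_pmf {v. \<bar>real v - M\<bar> > t + e1 + e2} =
        measure_pmf.expectation kept_pmf (\<lambda>v. of_bool (\<bar>real v - M\<bar> > t + e1 + e2))"
    by (rule prob_eq_expectation)
  also have "\<dots> \<le> N * (1 - \<delta>) ^ j + N / 2 ^ r + 2 * exp (- (2 * t\<^sup>2 / (real m * B\<^sup>2)))"
  proof (rule expectation_kept_pmf_le[of m])
    fix ys assume "ys \<in> permutations_of_set E"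
    then have ys: "set ys = E"
      by (simp add: permutations_of_setD)
    have "expect m (\<lambda>xs. of_bool (\<bar>real (kept \<F> (ys @ xs)) - M\<bar> > t + e1 + e2)) \<le>
      expect m (\<lambda>xs. of_bool (unsaturated xs) +
        (of_bool (\<not> sparse D (set xs)) + of_bool (\<bar>g xs - expect m g\<bar> \<ge> t)))"
    proof (rule expect_mono)
      fix xs assume xs: "length xs = m" "set xs \<subseteq> E"
      show "of_bool (\<bar>real (kept \<F> (ys @ xs)) - M\<bar> > t + e1 + e2) \<le> of_bool (unsaturated xs) +
        (of_bool (\<not> sparse D (set xs)) + of_bool (\<bar>g xs - expect m g\<bar> \<ge> t) :: real)"
      proof (cases "unsaturated xs \<or> \<not> sparse D (set xs)")
        case False
        then have "real (kept \<F> (ys @ xs)) = g xs"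
          using kept_append_saturated[of xs ys] ys gf[of xs] xs by (simp add: G_def f_def)
        then show ?thesis
          using mean_f mean_fg by (auto simp: of_bool_def)
      qed auto
    qed
    also have "\<dots> = expect m (\<lambda>xs. of_bool (unsaturated xs)) +
        (expect m (\<lambda>xs. of_bool (\<not> sparse D (set xs))) +
         expect m (\<lambda>xs. of_bool (\<bar>g xs - expect m g\<bar> \<ge> t)))"
      by (simp only: Bochner_Integration.integral_add integrable_samples)
    also have "\<dots> \<le> N * (1 - \<delta>) ^ j + (N / 2 ^ r + 2 * exp (- (2 * t\<^sup>2 / (real m * B\<^sup>2))))"
      using expect_unsaturated[of m] block_pos not_sparse bounded_differences_tail[OF bd m B_pos assms(1)]
      by (intro add_mono) (auto simp: m_def)
    finally show "expect m (\<lambda>xs. of_bool (\<bar>real (kept \<F> (ys @ xs)) - M\<bar> > t + e1 + e2)) \<le>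
        N * (1 - \<delta>) ^ j + N / 2 ^ r + 2 * exp (- (2 * t\<^sup>2 / (real m * B\<^sup>2)))"
      by simp
  qed
  finally show ?thesis .
qed

end

subsection \<open>The hypergraph of copies\<close>

text \<open>A copy is recorded by its edge set, which is all that \<open>closed_by\<close> looks
  at.\<close>

definition copies :: "'a ugraph \<Rightarrow> nat \<Rightarrow> nat set set set" where
  "copies H n = edges ` {F. subgraph F (complete_graph n) \<and> graph_iso H F}"

lemma finite_edges_complete [simp]: "finite (edges (complete_graph n))"
  by (rule finite_subset[of _ "Pow {..<n}"]) (auto simp: complete_graph_def)

lemma card_edges_complete: "card (edges (complete_graph n)) = n choose 2"
  using n_subsets[of "{..<n}" 2] by (simp add: complete_graph_def)

lemma copy_edges_complete:
  assumes "S \<subseteq> edges (complete_graph n)"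
  shows "copy_edges H ((complete_graph n)\<lparr>edges := S\<rparr>) = \<Union>{A\<in>copies H n. A \<subseteq> S}"
  using assms unfolding copy_edges_def copies_def subgraph_def by fastforce

lemma final_edges_kept:
  "final_edges H n = map_pmf (kept (copies H n)) (pmf_of_set (permutations_of_set (edges (complete_graph n))))"
  unfolding final_edges_def by (rule edge_count_permutation) (simp_all add: copy_edges_complete)

lemma copies_iff:
  assumes "simple_graph H"
  shows "A \<in> copies H n \<longleftrightarrow>
    (\<exists>f. inj_on f (verts H) \<and> f ` verts H \<subseteq> {..<n} \<and> A = (`) f ` edges H)"
proof
  assume "A \<in> copies H n"
  then obtain F f where "subgraph F (complete_graph n)" "bij_betw f (verts H) (verts F)"
      "edges F = (`) f ` edges H" "A = edges F"
    unfolding copies_def graph_iso_def by auto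
  then show "\<exists>f. inj_on f (verts H) \<and> f ` verts H \<subseteq> {..<n} \<and> A = (`) f ` edges H"
    unfolding bij_betw_def subgraph_def complete_graph_def by (intro exI[of _ f]) auto
next
  assume "\<exists>f. inj_on f (verts H) \<and> f ` verts H \<subseteq> {..<n} \<and> A = (`) f ` edges H"
  then obtain f where f: "inj_on f (verts H)" "f ` verts H \<subseteq> {..<n}" "A = (`) f ` edges H"
    by blast
  let ?F = "\<lparr>verts = f ` verts H, edges = A\<rparr>"
  have card: "card (f ` e) = 2" "f ` e \<subseteq> f ` verts H" if "e \<in> edges H" for e
  proof -
    have e: "e \<subseteq> verts H" "card e = 2"
      using assms that unfolding simple_graph_def by auto
    show "card (f ` e) = 2"
      using e card_image[OF inj_on_subset[OF f(1) e(1)]] by simp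
    show "f ` e \<subseteq> f ` verts H"
      using e by blast
  qed
  have "subgraph ?F (complete_graph n)"
    using card f assms unfolding subgraph_def simple_graph_def complete_graph_def by fastforce
  moreover have "graph_iso H ?F"
    unfolding graph_iso_def using f by (auto simp: bij_betw_def)
  ultimately show "A \<in> copies H n"
    unfolding copies_def by (force intro: image_eqI[where x = ?F])
qed

lemma card_Union_two_sets_ge_3:
  assumes "finite (\<Union>X)" "\<And>e. e \<in> X \<Longrightarrow> card e = 2" "card X \<ge> 2"
  shows "card (\<Union>X) \<ge> 3"
proof (rule ccontr)
  assume "\<not> card (\<Union>X) \<ge> 3"
  then have "e = \<Union>X" if "e \<in> X" for e
    using that assms(1,2) card_seteq[of "\<Union>X" e] by force
  then have "X \<subseteq> {\<Union>X}"
    by blast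
  then have "card X \<le> 1"
    using card_mono[of "{\<Union>X}" X] by simp
  then show False
    using assms(3) by simp
qed

section \<open>Counting the copies of a 2-balanced graph\<close>

locale balanced_graph =
  fixes H :: "'a ugraph"
  assumes simple: "simple_graph H" and balanced: "two_balanced H"
begin

abbreviation v :: nat where "v \<equiv> card (verts H)"
abbreviation k :: nat where "k \<equiv> card (edges H)"

lemma finite_verts [simp]: "finite (verts H)"
  using simple by (simp add: simple_graph_def)

lemma edge_props: "e \<in> edges H \<Longrightarrow> e \<subseteq> verts H \<and> card e = 2"
  using simple by (simp add: simple_graph_def)

lemma edges_Pow: "edges H \<subseteq> Pow (verts H)"
  using edge_props by auto

lemma finite_edges [simp]: "finite (edges H)"
  by (rule finite_subset[OF edges_Pow]) simp

lemma k_ge_2: "k \<ge> 2"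
  using balanced by (simp add: two_balanced_def)

lemma edges_nonempty [simp]: "edges H \<noteq> {}"
  using k_ge_2 by fastforce

lemma finite_Union_edges [simp]: "J \<subseteq> edges H \<Longrightarrow> finite (\<Union>J)"
  by (rule finite_subset[of _ "verts H"]) (use edge_props in auto)

lemma v_ge_3: "v \<ge> 3"
proof -
  have "3 \<le> card (\<Union>(edges H))"
    using k_ge_2 edge_props by (intro card_Union_two_sets_ge_3) auto
  also have "\<dots> \<le> v"
    using edge_props by (intro card_mono) auto
  finally show ?thesis .
qed

lemma d2_eq: "d2 H * (real v - 2) = real k - 1"
  using v_ge_3 by (simp add: d2_def)

lemma d2_pos: "d2 H > 0"
  using v_ge_3 k_ge_2 by (simp add: d2_def)

lemma subgraph_edges:
  assumes "J \<subseteq> edges H"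
  shows "subgraph \<lparr>verts = \<Union>J, edges = J\<rparr> H"
  using assms edge_props unfolding subgraph_def simple_graph_def by auto

text \<open>2-balancedness for the subgraph spanned by \<open>J\<close>, with the denominator
  cleared. In this form it also covers a single edge, where both sides vanish.\<close>

lemma subgraph_density:
  assumes "J \<subseteq> edges H" "J \<noteq> {}"
  shows "real (card J) - 1 \<le> d2 H * (real (card (\<Union>J)) - 2)"
proof (cases "card J \<ge> 2")
  case True
  let ?G = "\<lparr>verts = \<Union>J, edges = J\<rparr>"
  have card: "card (\<Union>J) \<ge> 3"
    using assms edge_props True by (intro card_Union_two_sets_ge_3) auto
  have "d2 ?G \<le> d2 H"
    using balanced subgraph_edges[OF assms(1)] card unfolding two_balanced_def
    by (cases "?G = H") auto
  then show ?thesis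
    using card by (simp add: d2_def[of ?G] field_simps)
next
  case False
  have "card J > 0"
    using assms finite_subset[OF assms(1)] by (simp add: card_gt_0_iff)
  then have one: "card J = 1"
    using False by simp
  obtain e where "e \<in> J"
    using assms(2) by blast
  then have "card e \<le> card (\<Union>J)"
    using assms by (intro card_mono) auto
  then show ?thesis
    using one d2_pos edge_props \<open>e \<in> J\<close> assms(1) by (auto simp: subset_iff)
qed

text \<open>An isolated vertex could be removed to obtain a proper subgraph with the same edges and
  larger \<open>d2\<close>.\<close>

lemma Union_edges: "\<Union>(edges H) = verts H"
proof (rule ccontr)
  assume ne: "\<Union>(edges H) \<noteq> verts H"
  have "\<Union>(edges H) \<subset> verts H"
    using ne edge_props by blast
  then have less: "card (\<Union>(edges H)) < v"
    by (intro psubset_card_mono) auto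
  have "real k - 1 \<le> d2 H * (real (card (\<Union>(edges H))) - 2)"
    using k_ge_2 by (intro subgraph_density) auto
  also have "\<dots> < d2 H * (real v - 2)"
    using less d2_pos by simp
  finally show False
    by (simp add: d2_eq)
qed

text \<open>Without isolated vertices \<open>v \<le> 2 * k\<close>. This makes the exponent
  \<open>2 - 1 / d2 H\<close> nonnegative, which \<open>Nq_ge\<close> relies on.\<close>

lemma d2_ge_half: "1 / 2 \<le> d2 H"
proof -
  have "v \<le> (\<Sum>e\<in>edges H. card e)"
    using card_Union_le_sum_card[of "edges H"] by (simp add: Union_edges)
  also have "\<dots> = k * 2"
    using edge_props by simp
  finally have "real v \<le> real (k * 2)"
    by (simp only: of_nat_le_iff)
  then have "real v - 2 \<le> 2 * (real k - 1)"
    by simp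
  then show ?thesis
    using v_ge_3 by (simp add: d2_def field_simps)
qed

lemma copies_edges: "A \<in> copies H n \<Longrightarrow> A \<subseteq> edges (complete_graph n)"
  by (auto simp: copies_def subgraph_def)

lemma copiesE:
  assumes "A \<in> copies H n"
  obtains f where "inj_on f (verts H)" "f ` verts H \<subseteq> {..<n}" "A = (`) f ` edges H"
  using iffD1[OF copies_iff[OF simple] assms] by (elim exE conjE)

lemma copies_card:
  assumes "A \<in> copies H n"
  shows "card A = k"
proof -
  obtain f where f: "inj_on f (verts H)" "f ` verts H \<subseteq> {..<n}" "A = (`) f ` edges H"
    using assms by (rule copiesE)
  have "inj_on ((`) f) (edges H)"
    by (rule inj_on_subset[OF inj_on_image_Pow[OF f(1)] edges_Pow])
  then show ?thesis
    using f(3) by (simp add: card_image)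
qed

lemma finite_copies [simp]: "finite (copies H n)"
  by (rule finite_subset[of _ "Pow (edges (complete_graph n))"]) (use copies_edges in auto)

text \<open>
  The edges that an embedding maps into \<open>J\<close> span a set \<open>W\<close> of as many vertices as \<open>J\<close> does, and
  the embedding maps \<open>W\<close> into the vertices of \<open>J\<close>.
\<close>

lemma copy_over:
  assumes "A \<in> copies H n" "J \<subseteq> A"
  obtains f J0 where "inj_on f (verts H)" "f ` verts H \<subseteq> {..<n}" "A = (`) f ` edges H"
    "J0 \<subseteq> edges H" "card J0 = card J" "f ` \<Union>J0 = \<Union>J" "card (\<Union>J0) = card (\<Union>J)"
proof -
  obtain f where f: "inj_on f (verts H)" "f ` verts H \<subseteq> {..<n}" "A = (`) f ` edges H"
    using assms(1) by (rule copiesE)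
  define J0 where "J0 = {e\<in>edges H. f ` e \<in> J}"
  have sub: "J0 \<subseteq> edges H"
    by (auto simp: J0_def)
  have img: "(`) f ` J0 = J"
    using assms(2) f(3) by (auto simp: J0_def)
  have "inj_on ((`) f) J0"
    by (rule inj_on_subset[OF inj_on_image_Pow[OF f(1)] order_trans[OF sub edges_Pow]])
  then have "card J0 = card J"
    using img card_image by fastforce
  moreover have Un: "f ` \<Union>J0 = \<Union>J"
    using img by (metis image_Union)
  moreover have "inj_on f (\<Union>J0)"
    by (rule inj_on_subset[OF f(1)]) (use order_trans[OF sub edges_Pow] in blast)
  then have "card (\<Union>J0) = card (\<Union>J)"
    using Un card_image by fastforce
  ultimately show ?thesis
    using that f sub by blast
qed

text \<open>Every copy over \<open>J\<close> arises from a map that sends some \<open>W\<close> with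
  \<open>card (\<Union>J)\<close> vertices into \<open>\<Union>J\<close> and the other vertices
  anywhere. There are at most \<open>2 ^ v\<close> choices of \<open>W\<close>, at most
  \<open>v ^ v\<close> maps on \<open>W\<close>, and \<open>n\<close> images for each remaining
  vertex.\<close>

lemma card_copies_superset_le:
  "card {A\<in>copies H n. J \<subseteq> A} \<le> 2 ^ v * v ^ v * n ^ (v - card (\<Union>J))"
proof -
  define \<W> where "\<W> = {W. W \<subseteq> verts H \<and> card W = card (\<Union>J)}"
  define P where "P W = PiE (verts H) (\<lambda>x. if x \<in> W then \<Union>J else {..<n})" for W
  show ?thesis
  proof (cases "{A\<in>copies H n. J \<subseteq> A} = {}")
    case True
    then show ?thesis
      by (simp only: card.empty)
  next
    case False
    then obtain A where A: "A \<in> copies H n" "J \<subseteq> A"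
      by blast
    have finJ: "finite (\<Union>J)"
      by (rule finite_subset[of _ "{..<n}"])
        (use A copies_edges[OF A(1)] in \<open>auto simp: complete_graph_def\<close>)
    have fin\<W>: "finite \<W>"
      by (simp add: \<W>_def)
    have finP: "finite (P W)" for W
      unfolding P_def by (rule finite_PiE) (use finJ in auto)
    have sub: "{A\<in>copies H n. J \<subseteq> A} \<subseteq> (\<lambda>f. (`) f ` edges H) ` (\<Union>W\<in>\<W>. P W)"
    proof
      fix B assume "B \<in> {A\<in>copies H n. J \<subseteq> A}"
      then have B: "B \<in> copies H n" "J \<subseteq> B"
        by simp_all
      obtain f J0 where f: "inj_on f (verts H)" "f ` verts H \<subseteq> {..<n}" "B = (`) f ` edges H"
        and J0: "J0 \<subseteq> edges H" "card J0 = card J" "f ` \<Union>J0 = \<Union>J" "card (\<Union>J0) = card (\<Union>J)"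
        using B by (rule copy_over)
      have W: "\<Union>J0 \<in> \<W>"
        using J0 edge_props by (auto simp: \<W>_def)
      have "f x \<in> (if x \<in> \<Union>J0 then \<Union>J else {..<n})" if "x \<in> verts H" for x
        using f(2) imageI[of x "\<Union>J0" f] that unfolding J0(3) by auto
      then have "restrict f (verts H) \<in> P (\<Union>J0)"
        unfolding P_def by (intro restrict_PiE_iff[THEN iffD2] ballI)
      moreover have "restrict f (verts H) ` e = f ` e" if "e \<in> edges H" for e
        using edge_props[OF that] by auto
      then have "B = (\<lambda>f. (`) f ` edges H) (restrict f (verts H))"
        unfolding f(3) by (simp add: image_def)
      ultimately show "B \<in> (\<lambda>f. (`) f ` edges H) ` (\<Union>W\<in>\<W>. P W)"
        using W by blast
    qed
    have cardP: "card (P W) \<le> v ^ v * n ^ (v - card (\<Union>J))" if "W \<in> \<W>" for W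
    proof -
      have W: "W \<subseteq> verts H" "card W = card (\<Union>J)"
        using that by (auto simp: \<W>_def)
      have "card (P W) = (\<Prod>x\<in>verts H. if x \<in> W then card (\<Union>J) else n)"
        unfolding P_def by (subst card_PiE) (auto intro!: prod.cong)
      also have "\<dots> = card (\<Union>J) ^ card (verts H \<inter> W) * n ^ card (verts H \<inter> - W)"
        by (simp add: prod.If_cases)
      also have "verts H \<inter> W = W"
        using W by blast
      also have "card (verts H \<inter> - W) = v - card (\<Union>J)"
        using W card_Diff_subset[of W "verts H"] finite_subset[OF W(1)] by (simp add: Diff_eq)
      also have "card (\<Union>J) ^ card W \<le> v ^ v"
      proof -
        have le: "card W \<le> v"
          using W by (intro card_mono) auto
        then have "card (\<Union>J) ^ card W \<le> v ^ card W"
          using W by (intro power_mono) auto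
        also have "\<dots> \<le> v ^ v"
          using le v_ge_3 by (intro power_increasing) auto
        finally show ?thesis .
      qed
      finally show ?thesis
        by simp
    qed
    have "card {A\<in>copies H n. J \<subseteq> A} \<le> card (\<Union>W\<in>\<W>. P W)"
      by (rule surj_card_le[OF _ sub]) (use fin\<W> finP in auto)
    also have "\<dots> \<le> (\<Sum>W\<in>\<W>. card (P W))"
      by (rule card_UN_le[OF fin\<W>])
    also have "\<dots> \<le> card \<W> * (v ^ v * n ^ (v - card (\<Union>J)))"
      using sum_mono[of \<W> "\<lambda>W. card (P W)", OF cardP] by simp
    also have "card \<W> \<le> 2 ^ v"
    proof -
      have "card \<W> \<le> card (Pow (verts H))"
        by (intro card_mono) (auto simp: \<W>_def)
      then show ?thesis
        by (simp add: card_Pow)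
    qed
    finally show ?thesis
      by (simp add: mult.assoc)
  qed
qed

text \<open>Send a fixed edge \<open>{x, y}\<close> of \<open>H\<close> to \<open>e\<close>. Every
  injective map \<open>g\<close> of the other \<open>v - 2\<close> vertices into the complement of
  \<open>e\<close> completes this to a copy \<open>A\<close> containing \<open>e\<close>, and
  \<open>g\<close> takes its values in the \<open>v\<close> vertices of \<open>A\<close>. Hence one
  copy accounts for at most \<open>v ^ (v - 2)\<close> such maps.\<close>

lemma card_copies_at_edge_ge:
  assumes "e \<in> edges (complete_graph n)"
  shows "(n - v) ^ (v - 2) \<le> v ^ v * card {A\<in>copies H n. e \<in> A}"
proof -
  obtain a b where e: "e = {a, b}" "a \<noteq> b" "a < n" "b < n"
    using assms by (auto simp: complete_graph_def card_2_iff)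
  obtain h where "h \<in> edges H"
    using k_ge_2 by fastforce
  then obtain x y where h: "{x, y} \<in> edges H" "x \<noteq> y" "x \<in> verts H" "y \<in> verts H"
    using edge_props[of h] by (auto simp: card_2_iff)
  let ?V = "verts H - {x, y}" and ?T = "{A\<in>copies H n. e \<in> A}"
  define G where "G = {g \<in> ?V \<rightarrow>\<^sub>E ({..<n} - e). inj_on g ?V}"
  have cardV: "card ?V = v - 2"
    using h by (simp add: card_Diff_subset)
  have card_Union: "card (\<Union>A) = v" if "A \<in> copies H n" for A
  proof -
    obtain f where "inj_on f (verts H)" "f ` verts H \<subseteq> {..<n}" "A = (`) f ` edges H"
      using \<open>A \<in> copies H n\<close> by (rule copiesE)
    moreover from this have "\<Union>A = f ` verts H"
      by (simp add: image_Union flip: Union_edges)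
    ultimately show ?thesis
      by (simp add: card_image)
  qed
  have "G \<subseteq> (\<Union>A\<in>?T. ?V \<rightarrow>\<^sub>E \<Union>A)"
  proof
    fix g assume g: "g \<in> G"
    define f where "f = g(x := a, y := b)"
    define A where "A = (`) f ` edges H"
    have on: "f z = g z" if "z \<in> ?V" for z
      using that by (auto simp: f_def)
    have range: "g z < n \<and> g z \<noteq> a \<and> g z \<noteq> b" if "z \<in> ?V" for z
      using g that by (auto simp: G_def e PiE_iff)
    have xy: "f x = a" "f y = b"
      using h by (auto simp: f_def)
    have split: "verts H = insert x (insert y ?V)"
      using h by blast
    have inj: "inj_on f ?V"
    proof -
      have "inj_on g ?V"
        using g unfolding G_def by blast
      then show ?thesis
        using inj_on_cong[of ?V f g, OF on] by blast
    qed
    have "f ` ?V = g ` ?V"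
      using on by (rule image_cong[OF refl])
    moreover have "a \<notin> g ` ?V" "b \<notin> g ` ?V"
      using range by blast+
    moreover have "insert y ?V - {x} = insert y ?V" "?V - {y} = ?V"
      using h(2) by auto
    ultimately have "inj_on f (insert x (insert y ?V))"
      using inj xy e(2) by (simp only: inj_on_insert image_insert insert_iff simp_thms)
    then have "inj_on f (verts H)"
      using split by simp
    moreover have "f ` verts H \<subseteq> {..<n}"
      using range on xy e by (subst split) auto
    ultimately have "A \<in> copies H n"
      unfolding copies_iff[OF simple] A_def by (intro exI[of _ f] conjI refl)
    moreover have "e \<in> A"
    proof -
      have "f ` {x, y} = e"
        using xy e(1) by simp
      then show ?thesis
        using h(1) unfolding A_def by blast
    qed
    moreover have "g \<in> ?V \<rightarrow>\<^sub>E \<Union>A"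
    proof
      fix z assume z: "z \<in> ?V"
      then obtain e' where "e' \<in> edges H" "z \<in> e'"
        using Union_edges by blast
      then have "f z \<in> \<Union>A"
        unfolding A_def by blast
      then show "g z \<in> \<Union>A"
        by (simp only: on[OF z])
    next
      fix z assume "z \<notin> ?V"
      then show "g z = undefined"
        using g unfolding G_def by (auto intro: PiE_arb)
    qed
    ultimately show "g \<in> (\<Union>A\<in>?T. ?V \<rightarrow>\<^sub>E \<Union>A)"
      by blast
  qed
  moreover have "finite (\<Union>A\<in>?T. ?V \<rightarrow>\<^sub>E \<Union>A)"
  proof (intro finite_UN_I finite_PiE)
    fix A z assume "A \<in> ?T" "z \<in> ?V"
    then show "finite (\<Union>A)"
      using card_Union[of A] v_ge_3 by (intro card_ge_0_finite) simp
  qed simp_all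
  ultimately have "card G \<le> card (\<Union>A\<in>?T. ?V \<rightarrow>\<^sub>E \<Union>A)"
    by (intro card_mono)
  also have "\<dots> \<le> (\<Sum>A\<in>?T. card (?V \<rightarrow>\<^sub>E \<Union>A))"
    by (intro card_UN_le) simp
  also have "\<dots> = (\<Sum>A\<in>?T. v ^ (v - 2))"
    by (intro sum.cong) (simp_all add: card_funcsetE cardV card_Union)
  also have "\<dots> = v ^ (v - 2) * card ?T"
    by simp
  also have "\<dots> \<le> v ^ v * card ?T"
    using v_ge_3 by (intro mult_le_mono1 power_increasing) auto
  finally have upper: "card G \<le> v ^ v * card ?T" .
  have "card ({..<n} - e) = n - 2"
    using e by (simp add: card_Diff_subset)
  then have "card G = (\<Prod>i\<in>{0..<v - 2}. n - 2 - i)"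
    unfolding G_def using card_inj_on_subset_funcset[of ?V "{..<n} - e" ?V] cardV by simp
  moreover have "(\<Prod>i\<in>{0..<v - 2}. n - v) \<le> (\<Prod>i\<in>{0..<v - 2}. n - 2 - i)"
    by (rule prod_mono) auto
  ultimately show ?thesis
    using upper by simp
qed

text \<open>The value of \<open>q\<close>: then \<open>(1 / q) ^ (k - 1)\<close> equals
  \<open>n ^ (v - 2)\<close>, the order of the number of copies through an edge.\<close>

definition scale :: "nat \<Rightarrow> real" where
  "scale n = real n powr (- 1 / d2 H)"

lemma inverse_scale_power:
  assumes "n > 0"
  shows "(1 / scale n) ^ i = real n powr (real i / d2 H)"
proof -
  have "1 / scale n = real n powr (1 / d2 H)"
    using assms by (simp add: scale_def powr_minus_divide)
  then show ?thesis
    using assms by (simp add: powr_power mult.commute)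
qed

lemma real_choose_two: "n \<ge> 2 \<Longrightarrow> real (n choose 2) = real n * (real n - 1) / 2"
  by (simp add: choose_two real_of_nat_div of_nat_diff)

lemma edges_scale_ge:
  assumes "n \<ge> 2"
  shows "real n powr (2 - 1 / d2 H) / 4 \<le> real (n choose 2) * scale n"
proof -
  have "real n * real n \<le> real n * (2 * (real n - 1))"
    using assms by (intro mult_left_mono) auto
  then have "(real n)\<^sup>2 / 4 \<le> real (n choose 2)"
    using assms by (simp add: real_choose_two power2_eq_square)
  then have "(real n)\<^sup>2 / 4 * scale n \<le> real (n choose 2) * scale n"
    by (intro mult_right_mono) (simp_all add: scale_def)
  moreover have "real n powr (2 - 1 / d2 H) = (real n)\<^sup>2 * scale n"
    using assms by (simp add: scale_def powr_diff powr_minus_divide)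
  ultimately show ?thesis
    by simp
qed

lemma edges_le: "n \<ge> 2 \<Longrightarrow> real (n choose 2) \<le> (real n)\<^sup>2"
  by (simp add: real_choose_two power2_eq_square field_simps)

lemma edges_scale_le:
  assumes "n \<ge> 2"
  shows "real (n choose 2) * scale n \<le> real n powr (2 - 1 / d2 H)"
proof -
  have "real (n choose 2) * scale n \<le> (real n)\<^sup>2 * scale n"
    using edges_le[OF assms] by (intro mult_right_mono) (simp_all add: scale_def)
  moreover have "real n powr (2 - 1 / d2 H) = (real n)\<^sup>2 * scale n"
    using assms by (simp add: scale_def powr_diff powr_minus_divide)
  ultimately show ?thesis
    by simp
qed

text \<open>For \<open>n \<ge> 2 * v\<close> the bound \<open>n - v \<ge> n / 2\<close> produces the
  factor \<open>2 ^ (v - 2)\<close> in the lower degree constant. The codegrees are of order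
  \<open>n ^ (v - card (\<Union>J))\<close>, and 2-balancedness compares this exponent with
  \<open>(k - card J) / d2 H\<close>.\<close>

lemma regular_hypergraph_copies:
  assumes n: "n \<ge> 2 * v"
  shows "regular_hypergraph (edges (complete_graph n)) (copies H n) k (scale n)
           (1 / (2 ^ (v - 2) * real v ^ v)) (2 ^ v * real v ^ v)"
proof unfold_locales
  have n2: "n \<ge> 2"
    using n v_ge_3 by simp
  show "finite (edges (complete_graph n))"
    by simp
  show "edges (complete_graph n) \<noteq> {}"
  proof -
    have "card (edges (complete_graph n)) > 0"
      using n2 by (simp add: card_edges_complete)
    then show ?thesis
      by (metis card.empty less_numeral_extra(3))
  qed
  show "A \<subseteq> edges (complete_graph n)" "card A = k" if "A \<in> copies H n" for A
    using that copies_edges copies_card by auto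
  show "2 \<le> k"
    by (rule k_ge_2)
  show "0 < scale n"
    using n2 by (simp add: scale_def)
  show "scale n \<le> 1"
    using n2 d2_pos powr_mono[of "- 1 / d2 H" 0 "real n"] by (simp add: scale_def)
  have "1 \<le> real n powr (2 - 1 / d2 H)"
    using n2 d2_ge_half by (intro ge_one_powr_ge_zero) (simp_all add: field_simps)
  then show "1 / 4 \<le> real (card (edges (complete_graph n))) * scale n"
    using edges_scale_ge[OF n2] by (simp add: card_edges_complete)
  show "0 < 1 / (2 ^ (v - 2) * real v ^ v)"
    using v_ge_3 by simp
  show "1 / (2 ^ (v - 2) * real v ^ v) * (1 / scale n) ^ (k - 1) \<le> real (card {A\<in>copies H n. e \<in> A})"
    if e: "e \<in> edges (complete_graph n)" for e
  proof -
    have "real (k - 1) / d2 H = real (v - 2)"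
      using d2_eq d2_pos k_ge_2 v_ge_3 by (simp add: field_simps of_nat_diff)
    then have "(1 / scale n) ^ (k - 1) = real n ^ (v - 2)"
      using n2 by (simp add: inverse_scale_power powr_realpow)
    moreover have "(real n / 2) ^ (v - 2) \<le> real v ^ v * real (card {A\<in>copies H n. e \<in> A})"
    proof -
      have "(real n / 2) ^ (v - 2) \<le> real (n - v) ^ (v - 2)"
        using n by (intro power_mono) auto
      also have "\<dots> = real ((n - v) ^ (v - 2))"
        by simp
      also have "\<dots> \<le> real (v ^ v * card {A\<in>copies H n. e \<in> A})"
        using card_copies_at_edge_ge[OF e] by (simp only: of_nat_le_iff)
      finally show ?thesis
        by simp
    qed
    ultimately show ?thesis
      using v_ge_3 by (simp add: power_divide field_simps)
  qed
  show "real (card {A\<in>copies H n. J \<subseteq> A}) \<le> 2 ^ v * real v ^ v * (1 / scale n) ^ (k - card J)"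
    if J: "J \<noteq> {}" "J \<subseteq> edges (complete_graph n)" "card J \<le> k" for J
  proof (cases "{A\<in>copies H n. J \<subseteq> A} = {}")
    case True
    then show ?thesis
      using n2 by (simp only: card.empty) (simp add: scale_def)
  next
    case False
    then obtain A where A: "A \<in> copies H n" "J \<subseteq> A"
      by blast
    obtain f J0 where f: "inj_on f (verts H)" "f ` verts H \<subseteq> {..<n}" "A = (`) f ` edges H"
      and J0: "J0 \<subseteq> edges H" "card J0 = card J" "f ` \<Union>J0 = \<Union>J" "card (\<Union>J0) = card (\<Union>J)"
      using A by (rule copy_over)
    have "card J > 0"
      using J finite_subset[OF J(2)] by (simp add: card_gt_0_iff)
    then have "J0 \<noteq> {}"
      using J0(2) by auto
    then have dens: "real (card J) - 1 \<le> d2 H * (real (card (\<Union>J)) - 2)"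
      using subgraph_density[OF J0(1)] J0 by simp
    have le_v: "card (\<Union>J) \<le> v"
      using J0 card_mono[of "verts H" "\<Union>J0"] order_trans[OF J0(1) edges_Pow] by fastforce
    \<comment> \<open>Subtract the density bound for \<open>J\<close> from the equality
      \<open>d2_eq\<close> for \<open>H\<close>.\<close>
    have "d2 H * real (v - card (\<Union>J)) \<le> real (k - card J)"
      using dens d2_eq le_v J(3) by (simp add: of_nat_diff algebra_simps)
    then have exponent: "real (v - card (\<Union>J)) \<le> real (k - card J) / d2 H"
      using d2_pos by (simp add: field_simps)
    have "real (card {A\<in>copies H n. J \<subseteq> A}) \<le> real (2 ^ v * v ^ v * n ^ (v - card (\<Union>J)))"
      using card_copies_superset_le by (simp only: of_nat_le_iff)
    also have "\<dots> = 2 ^ v * real v ^ v * real n powr real (v - card (\<Union>J))"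
      using n2 by (simp add: powr_realpow)
    also have "\<dots> \<le> 2 ^ v * real v ^ v * real n powr (real (k - card J) / d2 H)"
      using exponent n2 by (intro mult_left_mono powr_mono) auto
    finally show ?thesis
      using n2 by (simp add: inverse_scale_power)
  qed
qed

end

section \<open>Choice of parameters on the logarithmic scale\<close>

context regular_hypergraph
begin

text \<open>Makes the Lipschitz constant at most \<open>\<beta> * L ^ (2 * (k - 1))\<close>: with
  \<open>r = j \<le> 2 * L\<^sup>2\<close> the base \<open>r * k + 5 * k * j\<close> is at most
  \<open>12 * k * L\<^sup>2\<close>.\<close>

definition \<beta> :: real where
  "\<beta> = 2 + 4 * real k * C * (12 * real k) ^ (k - 1)"

text \<open>Here \<open>L\<close> stands for the logarithm of \<open>n\<close>, and
  \<open>kept_concentration\<close> is applied with \<open>j\<close> and \<open>r\<close> both equal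
  to \<open>L\<^sup>2\<close> rounded up. The assumptions \<open>small1\<close> to
  \<open>small3\<close> give each failure probability a third of the total, while
  \<open>small4\<close> and \<open>small5\<close> control the shifts \<open>e1\<close> and
  \<open>e2\<close>; all hold for large \<open>L\<close>, as a quadratic exponent beats a linear
  one.\<close>

lemma kept_concentration_log:
  assumes L: "L \<ge> 1" and N: "N \<le> exp (2 * L)" and a: "a > 0"
    and small1: "exp (2 * L - \<delta> * L\<^sup>2) \<le> exp (- (a * L)) / 3"
    and small2: "exp (2 * L - 1 / 2 * L\<^sup>2) \<le> exp (- (a * L)) / 3"
    and small3: "2 * exp (- (\<epsilon> / (40 * real k * \<beta>\<^sup>2) * L\<^sup>2)) \<le> exp (- (a * L)) / 3"
    and small4: "exp (4 * L - \<delta> * L\<^sup>2) \<le> sqrt (\<epsilon> / 8) / 4"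
    and small5: "10 * real k * (1 + \<beta>) * exp ((6 + 2 * real k) * L - 1 / 2 * L\<^sup>2) \<le> sqrt (\<epsilon> / 8) / 4"
  shows "measure_pmf.prob kept_pmf {v. \<bar>real v - M\<bar> \<le> sqrt M * L ^ (4 * k)} \<ge> 1 - exp (- (a * L))"
proof -
  define j where "j = nat \<lceil>L\<^sup>2\<rceil>"
  define B where "B = 2 * (1 + real k * (2 * (C * (real (j * k) + 5 * real k * real j) ^ (k - 1))))"
  define m where "m = j * block"
  \<comment> \<open>Half of the permitted deviation; the other half pays for \<open>e1\<close> and
    \<open>e2\<close>.\<close>
  define t where "t = sqrt M * L ^ (4 * k) / 2"
  define e1 where "e1 = N * (N * (1 - \<delta>) ^ j)"
  define e2 where "e2 = real m * (1 + B) * (N / 2 ^ j)"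
  have L2: "1 \<le> L\<^sup>2"
    using L by simp
  have j: "L\<^sup>2 \<le> real j" "real j \<le> 2 * L\<^sup>2" "j > 0"
    using L2 unfolding j_def by linarith+
  have eps: "\<epsilon> > 0"
    using C_pos by (simp add: \<epsilon>_def)
  have beta: "\<beta> \<ge> 2"
    using C_pos by (simp add: \<beta>_def)
  have M: "\<epsilon> * (N * q) / 2 \<le> M"
    by (rule M_ge)
  have M_ge8: "\<epsilon> / 8 \<le> M"
  proof -
    have "\<epsilon> * (1 / 4) \<le> \<epsilon> * (N * q)"
      using Nq_ge eps by (intro mult_left_mono) auto
    then show ?thesis
      using M by simp
  qed
  have M_pos: "M > 0"
    using M_ge8 eps by linarith

  have pow1: "(1 - \<delta>) ^ j \<le> exp (- (\<delta> * L\<^sup>2))"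
  proof -
    have "(1 - \<delta>) ^ j \<le> exp (- \<delta>) ^ j"
      using \<delta>_le_1 exp_ge_add_one_self[of "- \<delta>"] by (intro power_mono) auto
    also have "\<dots> = exp (- (\<delta> * real j))"
      by (simp add: exp_of_nat_mult[symmetric] mult.commute)
    also have "\<dots> \<le> exp (- (\<delta> * L\<^sup>2))"
      using j \<delta>_pos by simp
    finally show ?thesis .
  qed
  have pow2: "1 / 2 ^ j \<le> exp (- (1 / 2 * L\<^sup>2))"
  proof -
    have "exp (1 / 2 :: real) \<le> 2"
    proof (rule power2_le_imp_le)
      show "(exp (1 / 2 :: real))\<^sup>2 \<le> 2\<^sup>2"
        using exp_le by (simp add: exp_double[symmetric])
    qed simp
    then have "(1 / 2) ^ j \<le> exp (- (1 / 2 :: real)) ^ j"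
      by (intro power_mono) (simp_all add: exp_minus field_simps)
    also have "\<dots> = exp (- (1 / 2 * real j))"
      by (simp add: exp_of_nat_mult[symmetric])
    also have "\<dots> \<le> exp (- (1 / 2 * L\<^sup>2))"
      using j by simp
    finally show ?thesis
      by (simp add: power_divide)
  qed
  have Npow1: "N * (1 - \<delta>) ^ j \<le> exp (2 * L - \<delta> * L\<^sup>2)"
    using mult_mono[OF N pow1] \<delta>_le_1 by (simp add: exp_add[symmetric])
  have Npow2: "N / 2 ^ j \<le> exp (2 * L - 1 / 2 * L\<^sup>2)"
    using mult_mono[OF N pow2] by (simp add: exp_add[symmetric])
  have Npow2_less: "N / 2 ^ j < 1"
  proof -
    have "exp (- (a * L)) \<le> 1"
      using a L by simp
    then show ?thesis
      using Npow2 small2 by linarith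
  qed

  have B_le: "B \<le> \<beta> * L ^ (2 * (k - 1))"
  proof -
    have Lp: "1 \<le> L ^ (2 * (k - 1))"
      using L by simp
    have "(real (j * k) + 5 * real k * real j) ^ (k - 1) = (6 * real k * real j) ^ (k - 1)"
      by (simp add: algebra_simps)
    also have "\<dots> \<le> (12 * real k * L\<^sup>2) ^ (k - 1)"
      using mult_left_mono[OF j(2), of "6 * real k"] by (intro power_mono) (auto simp: mult_ac)
    also have "\<dots> = (12 * real k) ^ (k - 1) * L ^ (2 * (k - 1))"
      by (simp add: power_mult_distrib power_mult)
    finally have "B \<le> 2 * (1 + real k * (2 * (C * ((12 * real k) ^ (k - 1) * L ^ (2 * (k - 1))))))"
      unfolding B_def using C_pos by (intro mult_left_mono add_left_mono) auto
    also have "\<dots> \<le> \<beta> * L ^ (2 * (k - 1))"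
      using Lp by (simp add: \<beta>_def algebra_simps)
    finally show ?thesis .
  qed
  have B_pos: "B > 0"
    unfolding B_def using C_pos by (simp add: add_pos_nonneg)
  have m_le: "real m \<le> 10 * real k * L\<^sup>2 * (N * q)"
  proof -
    have "real m \<le> (2 * L\<^sup>2) * (5 * real k * (N * q))"
      unfolding m_def of_nat_mult using j block_le by (intro mult_mono) auto
    then show ?thesis
      by (simp add: mult_ac)
  qed
  have m_pos: "m > 0"
    using j(3) block_pos by (simp add: m_def)

  have e1: "e1 \<le> sqrt (\<epsilon> / 8) / 4"
  proof -
    have "e1 \<le> exp (2 * L) * exp (2 * L - \<delta> * L\<^sup>2)"
      unfolding e1_def using N Npow1 \<delta>_le_1 by (intro mult_mono) auto
    also have "\<dots> = exp (4 * L - \<delta> * L\<^sup>2)"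
      by (simp add: exp_add[symmetric])
    finally show ?thesis
      using small4 by linarith
  qed
  have e2: "e2 \<le> sqrt (\<epsilon> / 8) / 4"
  proof -
    have L_exp: "L \<le> exp L"
      using exp_ge_add_one_self[of L] by linarith
    have Lsq: "L\<^sup>2 \<le> exp (2 * L)"
      using power_mono[OF L_exp, of 2] L by (simp add: exp_double)
    have "real m \<le> 10 * real k * exp (2 * L) * exp (2 * L)"
    proof -
      have "N * q \<le> exp (2 * L)"
        using N q_le_1 mult_left_mono[of q 1 N] by simp
      then have "10 * real k * L\<^sup>2 * (N * q) \<le> 10 * real k * exp (2 * L) * exp (2 * L)"
        using Lsq Nq_pos by (intro mult_mono) auto
      then show ?thesis
        using m_le by linarith
    qed
    moreover have "1 + B \<le> (1 + \<beta>) * exp (2 * real k * L)"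
    proof -
      have "L ^ (2 * (k - 1)) \<le> exp L ^ (2 * (k - 1))"
        using L L_exp by (intro power_mono) auto
      also have "\<dots> \<le> exp L ^ (2 * k)"
        using L by (intro power_increasing) auto
      also have "\<dots> = exp (2 * real k * L)"
        by (simp add: exp_of_nat_mult[symmetric])
      finally have "\<beta> * L ^ (2 * (k - 1)) \<le> \<beta> * exp (2 * real k * L)"
        using beta by (intro mult_left_mono) auto
      moreover have "1 \<le> exp (2 * real k * L)"
        using L by simp
      ultimately show ?thesis
        using B_le unfolding distrib_right by linarith
    qed
    ultimately have "e2 \<le> (10 * real k * exp (2 * L) * exp (2 * L)) *
        ((1 + \<beta>) * exp (2 * real k * L)) * exp (2 * L - 1 / 2 * L\<^sup>2)"
      unfolding e2_def using Npow2 B_pos beta by (intro mult_mono) auto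
    also have "\<dots> = 10 * real k * (1 + \<beta>) *
        (exp (2 * L) * exp (2 * L) * exp (2 * real k * L) * exp (2 * L - 1 / 2 * L\<^sup>2))"
      by (simp only: mult_ac)
    also have "exp (2 * L) * exp (2 * L) * exp (2 * real k * L) * exp (2 * L - 1 / 2 * L\<^sup>2) =
               exp ((6 + 2 * real k) * L - 1 / 2 * L\<^sup>2)"
      by (simp add: exp_add[symmetric] algebra_simps)
    finally show ?thesis
      using small5 by linarith
  qed
  have t_ge: "sqrt (\<epsilon> / 8) / 2 \<le> t"
  proof -
    have "sqrt (\<epsilon> / 8) * 1 \<le> sqrt M * L ^ (4 * k)"
      using M_ge8 L M_pos by (intro mult_mono) auto
    then show ?thesis
      by (simp add: t_def)
  qed
  then have t_sum: "t + e1 + e2 \<le> sqrt M * L ^ (4 * k)"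
    using e1 e2 by (simp add: t_def)
  have t_pos: "t > 0"
    using M_pos L by (simp add: t_def)
  \<comment> \<open>\<open>real m * B\<^sup>2\<close> is at most a constant times
    \<open>N * q * L ^ (4 * k - 2)\<close>, whereas \<open>t\<^sup>2\<close> is at least a constant
    times \<open>N * q * L ^ (8 * k)\<close>. Retaining a factor \<open>L\<^sup>2\<close> of the
    quotient is enough against \<open>a * L\<close>.\<close>
  have exponent: "\<epsilon> / (40 * real k * \<beta>\<^sup>2) * L\<^sup>2 \<le> 2 * t\<^sup>2 / (real m * B\<^sup>2)"
  proof -
    have "real m * B\<^sup>2 \<le> (10 * real k * L\<^sup>2 * (N * q)) * (\<beta> * L ^ (2 * (k - 1)))\<^sup>2"
      using m_le B_le B_pos Nq_pos by (intro mult_mono power_mono) auto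
    then have "\<epsilon> / (40 * real k * \<beta>\<^sup>2) * L\<^sup>2 * (real m * B\<^sup>2) \<le>
       \<epsilon> / (40 * real k * \<beta>\<^sup>2) * L\<^sup>2 * ((10 * real k * L\<^sup>2 * (N * q)) * (\<beta> * L ^ (2 * (k - 1)))\<^sup>2)"
      using eps by (intro mult_left_mono) auto
    also have "\<dots> = \<epsilon> * (N * q) / 4 * (L\<^sup>2 * L\<^sup>2 * (L ^ (2 * (k - 1)))\<^sup>2)"
      using k_ge_2 beta by (simp add: field_simps power2_eq_square)
    also have "L\<^sup>2 * L\<^sup>2 * (L ^ (2 * (k - 1)))\<^sup>2 = L ^ (4 * k)"
    proof -
      have "2 + 2 + 2 * (k - 1) * 2 = 4 * k"
        using k_ge_2 by simp
      then show ?thesis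
        by (metis power_add power_mult)
    qed
    also have "\<epsilon> * (N * q) / 4 * L ^ (4 * k) \<le> \<epsilon> * (N * q) / 4 * (L ^ (4 * k))\<^sup>2"
      using eps Nq_pos L self_le_power[of "L ^ (4 * k)" 2] by (intro mult_left_mono) auto
    also have "\<dots> \<le> M / 2 * (L ^ (4 * k))\<^sup>2"
    proof (rule mult_right_mono)
      show "\<epsilon> * (N * q) / 4 \<le> M / 2"
        using M by linarith
    qed simp
    also have "\<dots> = 2 * t\<^sup>2"
      using M_pos by (simp add: t_def power_mult_distrib power_divide)
    finally show ?thesis
      using m_pos B_pos by (simp add: pos_le_divide_eq)
  qed
  have "measure_pmf.prob kept_pmf {v. \<bar>real v - M\<bar> > t + e1 + e2} \<le>
          N * (1 - \<delta>) ^ j + N / 2 ^ j + 2 * exp (- (2 * t\<^sup>2 / (real m * B\<^sup>2)))"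
    unfolding e1_def e2_def m_def B_def by (rule kept_concentration) (use t_pos j Npow2_less in auto)
  also have "\<dots> \<le> exp (- (a * L))"
  proof -
    have "exp (- (2 * t\<^sup>2 / (real m * B\<^sup>2))) \<le> exp (- (\<epsilon> / (40 * real k * \<beta>\<^sup>2) * L\<^sup>2))"
      using exponent by simp
    then show ?thesis
      using Npow1 Npow2 small1 small2 small3 by linarith
  qed
  finally have "measure_pmf.prob kept_pmf (- {v. \<bar>real v - M\<bar> \<le> t + e1 + e2}) \<le> exp (- (a * L))"
    by (simp add: Collect_neg_eq[symmetric] not_le)
  then have "1 - exp (- (a * L)) \<le> measure_pmf.prob kept_pmf {v. \<bar>real v - M\<bar> \<le> t + e1 + e2}"
    using measure_pmf.prob_compl[of "{v. \<bar>real v - M\<bar> \<le> t + e1 + e2}" kept_pmf]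
    by (simp add: Compl_eq_Diff_UNIV)
  also have "\<dots> \<le> measure_pmf.prob kept_pmf {v. \<bar>real v - M\<bar> \<le> sqrt M * L ^ (4 * k)}"
    using t_sum by (intro measure_pmf.finite_measure_mono) auto
  finally show ?thesis .
qed

end

lemma eventually_exp_quadratic_le:
  fixes p \<kappa> a :: real
  assumes "\<kappa> > 0" "a > 0"
  shows "\<forall>\<^sub>F L in at_top. exp (p * L - \<kappa> * L\<^sup>2) \<le> a"
proof -
  have "filterlim (\<lambda>L. p * L - \<kappa> * L\<^sup>2) at_bot at_top"
    using assms(1) by real_asymp
  then have "((\<lambda>L. exp (p * L - \<kappa> * L\<^sup>2)) \<longlongrightarrow> 0) at_top"
    by (rule filterlim_compose[OF exp_at_bot])
  then have "\<forall>\<^sub>F L in at_top. exp (p * L - \<kappa> * L\<^sup>2) < a"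
    using assms(2) by (rule order_tendstoD)
  then show ?thesis
    by eventually_elim simp
qed

section \<open>Mean and concentration for the reverse free process\<close>

context balanced_graph
begin

lemma expected_final_edges_bounds:
  "\<exists>a A :: real. a > 0 \<and> A > 0 \<and>
    (\<forall>\<^sub>F n in sequentially.
       a * real n powr (2 - 1 / d2 H) \<le> expected_final_edges H n \<and>
       expected_final_edges H n \<le> A * real n powr (2 - 1 / d2 H))"
proof -
  \<comment> \<open>The constants of \<open>regular_hypergraph\<close> are fixed before
    \<open>n\<close>, so that they do not depend on it.\<close>
  define c C where "c = 1 / (2 ^ (v - 2) * real v ^ v)" and "C = 2 ^ v * real v ^ v"
  define \<epsilon> \<delta> where "\<epsilon> = 1 / (2 * (1 + C))" and "\<delta> = (c / 2 ^ (k - 1) / (C * (7 * real k) ^ (k - 1)))\<^sup>2"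
  have pos: "c > 0" "C > 0"
    using v_ge_3 by (simp_all add: c_def C_def)
  then have pos': "\<epsilon> > 0" "\<delta> > 0"
    using k_ge_2 by (simp_all add: \<epsilon>_def \<delta>_def)
  have bounds: "\<epsilon> / 8 * real n powr (2 - 1 / d2 H) \<le> expected_final_edges H n \<and>
        expected_final_edges H n \<le> 5 * real k / \<delta> * real n powr (2 - 1 / d2 H)"
    if n: "n \<ge> 2 * v" for n
  proof -
    interpret R: regular_hypergraph "edges (complete_graph n)" "copies H n" k "scale n" c C
      unfolding c_def C_def by (rule regular_hypergraph_copies[OF n])
    have n2: "n \<ge> 2"
      using n v_ge_3 by simp
    have "\<epsilon> / 8 * real n powr (2 - 1 / d2 H) = \<epsilon> / 2 * (real n powr (2 - 1 / d2 H) / 4)"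
      by simp
    also have "\<dots> \<le> \<epsilon> / 2 * (real (n choose 2) * scale n)"
      using pos' edges_scale_ge[OF n2] by (intro mult_left_mono) auto
    also have "\<dots> \<le> expected_final_edges H n"
      using R.M_ge unfolding final_edges_kept R.\<epsilon>_def \<epsilon>_def card_edges_complete by simp
    finally have lower: "\<epsilon> / 8 * real n powr (2 - 1 / d2 H) \<le> expected_final_edges H n" .
    have "expected_final_edges H n \<le> 5 * real k / \<delta> * (real (n choose 2) * scale n)"
      using R.M_le unfolding final_edges_kept R.\<delta>_def \<delta>_def card_edges_complete by simp
    also have "\<dots> \<le> 5 * real k / \<delta> * real n powr (2 - 1 / d2 H)"
      using pos' edges_scale_le[OF n2] by (intro mult_left_mono) auto
    finally show ?thesis
      using lower by simp
  qed
  have "\<forall>\<^sub>F n in sequentially. \<epsilon> / 8 * real n powr (2 - 1 / d2 H) \<le> expected_final_edges H n \<and>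
        expected_final_edges H n \<le> 5 * real k / \<delta> * real n powr (2 - 1 / d2 H)"
    using eventually_ge_at_top[of "2 * v"] by eventually_elim (rule bounds)
  moreover have "\<epsilon> / 8 > 0" "5 * real k / \<delta> > 0"
    using pos' k_ge_2 by auto
  ultimately show ?thesis
    by blast
qed

lemma final_edges_concentration:
  assumes a: "a > 0"
  shows "\<forall>\<^sub>F n in sequentially.
     measure_pmf.prob (final_edges H n)
       {m. \<bar>real m - expected_final_edges H n\<bar> \<le> sqrt (expected_final_edges H n) * ln (real n) ^ (4 * k)}
     \<ge> 1 - real n powr (- a)"
proof -
  define c C where "c = 1 / (2 ^ (v - 2) * real v ^ v)" and "C = 2 ^ v * real v ^ v"
  define \<epsilon> \<delta> \<beta> where "\<epsilon> = 1 / (2 * (1 + C))"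
    and "\<delta> = (c / 2 ^ (k - 1) / (C * (7 * real k) ^ (k - 1)))\<^sup>2"
    and "\<beta> = 2 + 4 * real k * C * (12 * real k) ^ (k - 1)"
  have pos: "c > 0" "C > 0"
    using v_ge_3 by (simp_all add: c_def C_def)
  then have pos': "\<epsilon> > 0" "\<delta> > 0" "\<beta> > 0"
    using k_ge_2 by (simp_all add: \<epsilon>_def \<delta>_def \<beta>_def add_pos_nonneg)
  have \<kappa>: "\<epsilon> / (40 * real k * \<beta>\<^sup>2) > 0"
    using pos' k_ge_2 by simp
  have A: "10 * real k * (1 + \<beta>) > 0"
    using pos' k_ge_2 by simp
  \<comment> \<open>The factor \<open>exp (- (a * L))\<close> is obtained by running the quadratic
    estimate with \<open>p + a\<close> in place of \<open>p\<close>.\<close>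
  have small: "\<forall>\<^sub>F L in at_top. exp (p * L - \<kappa> * L\<^sup>2) \<le> u * exp (- (a * L))"
    if "\<kappa> > 0" "u > 0" for p \<kappa> u
    using eventually_exp_quadratic_le[OF that, of "p + a"]
  proof eventually_elim
    case (elim L)
    have "exp (p * L - \<kappa> * L\<^sup>2) = exp ((p + a) * L - \<kappa> * L\<^sup>2) * exp (- (a * L))"
      by (simp add: exp_add[symmetric] algebra_simps)
    also have "\<dots> \<le> u * exp (- (a * L))"
      using elim by (intro mult_right_mono) auto
    finally show ?case .
  qed
  have ln: "filterlim (\<lambda>n. ln (real n)) at_top sequentially"
    by real_asymp
  have along_ln: "\<forall>\<^sub>F n in sequentially. P (ln (real n))" if "\<forall>\<^sub>F L in at_top. P L" for P
    using filterlim_iff[THEN iffD1, OF ln] that by blast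
  have s1: "\<forall>\<^sub>F n in sequentially. exp (2 * ln (real n) - \<delta> * (ln (real n))\<^sup>2) \<le> 1 / 3 * exp (- (a * ln (real n)))"
    by (rule along_ln[OF small]) (use pos' in auto)
  have s2: "\<forall>\<^sub>F n in sequentially. exp (2 * ln (real n) - 1 / 2 * (ln (real n))\<^sup>2) \<le> 1 / 3 * exp (- (a * ln (real n)))"
    by (rule along_ln[OF small]) auto
  \<comment> \<open>The case \<open>p = 0\<close>; a sixth becomes a third after the factor 2 of the
    two-sided tail.\<close>
  have s3: "\<forall>\<^sub>F n in sequentially. exp (0 * ln (real n) - \<epsilon> / (40 * real k * \<beta>\<^sup>2) * (ln (real n))\<^sup>2)
      \<le> 1 / 6 * exp (- (a * ln (real n)))"
    by (rule along_ln[OF small]) (use \<kappa> in auto)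
  have s4: "\<forall>\<^sub>F n in sequentially. exp (4 * ln (real n) - \<delta> * (ln (real n))\<^sup>2) \<le> sqrt (\<epsilon> / 8) / 4"
    by (rule along_ln[OF eventually_exp_quadratic_le]) (use pos' in auto)
  have s5: "\<forall>\<^sub>F n in sequentially. exp ((6 + 2 * real k) * ln (real n) - 1 / 2 * (ln (real n))\<^sup>2)
      \<le> sqrt (\<epsilon> / 8) / 4 / (10 * real k * (1 + \<beta>))"
    by (rule along_ln[OF eventually_exp_quadratic_le]) (use pos' A in auto)
  have s6: "\<forall>\<^sub>F n in sequentially. 1 \<le> ln (real n)"
    by (rule along_ln) (rule eventually_ge_at_top)
  show ?thesis
    using s1 s2 s3 s4 s5 s6 eventually_ge_at_top[of "2 * v"]
  proof eventually_elim
    case (elim n)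
    interpret R: regular_hypergraph "edges (complete_graph n)" "copies H n" k "scale n" c C
      unfolding c_def C_def by (rule regular_hypergraph_copies[OF elim(7)])
    have n2: "n \<ge> 2"
      using elim(7) v_ge_3 by simp
    have const_eqs: "R.\<epsilon> = \<epsilon>" "R.\<delta> = \<delta>" "R.\<beta> = \<beta>"
      by (simp_all only: R.\<epsilon>_def \<epsilon>_def R.\<delta>_def \<delta>_def R.\<beta>_def \<beta>_def)
    have N: "real (card (edges (complete_graph n))) \<le> exp (2 * ln (real n))"
      using edges_le[OF n2] n2 by (simp add: card_edges_complete exp_double)
    have small5: "10 * real k * (1 + \<beta>) * exp ((6 + 2 * real k) * ln (real n) - 1 / 2 * (ln (real n))\<^sup>2)
        \<le> sqrt (\<epsilon> / 8) / 4"
      using elim(5) A by (simp only: pos_le_divide_eq mult.commute)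
    have "1 - exp (- (a * ln (real n))) \<le> measure_pmf.prob (final_edges H n)
       {m. \<bar>real m - expected_final_edges H n\<bar> \<le> sqrt (expected_final_edges H n) * ln (real n) ^ (4 * k)}"
      unfolding final_edges_kept
      by (rule R.kept_concentration_log[OF elim(6) N a], unfold const_eqs)
        (use elim(1-4) small5 in simp_all)
    moreover have "exp (- (a * ln (real n))) = real n powr (- a)"
      using n2 by (simp add: powr_def)
    ultimately show ?case
      by simp
  qed
qed

end

theorem theorem19:
  fixes H :: "'a ugraph"
  assumes "simple_graph H" and "two_balanced H"
  shows "(\<exists>a A :: real. a > 0 \<and> A > 0 \<and>
            (\<forall>\<^sub>F n in sequentially.
               a * real n powr (2 - 1 / d2 H) \<le> expected_final_edges H n \<and>
               expected_final_edges H n \<le> A * real n powr (2 - 1 / d2 H))) \<and>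
         (\<forall>c::real. c > 0 \<longrightarrow>
            (\<forall>\<^sub>F n in sequentially.
               measure_pmf.prob (final_edges H n)
                 {m. \<bar>real m - expected_final_edges H n\<bar>
                      \<le> sqrt (expected_final_edges H n) * ln (real n) ^ (4 * card (edges H))}
               \<ge> 1 - real n powr (- c)))"
proof -
  interpret balanced_graph H
    using assms by unfold_locales
  show ?thesis
    using expected_final_edges_bounds final_edges_concentration by blast
qed

end
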